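(* Let $\Phi \colon G \to G'$ be a morphism of the discrete constrained Lagrangian systems $(G, N, L)$ and $(G', N', L')$. If $\mu_1', \ldots, \mu_n' \in T^\ast G'$ satisfies the discrete Lagrangian dynamics of $(G', N', L')$, then any $\Phi^\ast$-related sequence $\mu_1, \ldots, \mu_n \in T^\ast G$ (i.e., $\mu_k$ and $\mu_k'$ are $\Phi^\ast$-related for $k = 1, \ldots, n$) satisfies the discrete Lagrangian dynamics of $(G, N, L)$.
   Context: A Lie groupoid $G \rightrightarrows Q$ has submersions $\alpha, \beta \colon G \to Q$ (source, target), a smooth multiplication $gh$ defined for $(g,h) \in G_2 = \{(g,h) : \beta(g) = \alpha(h)\}$ and associative whenever defined, an identity section $\epsilon \colon Q \to G$ of $\alpha$ and $\beta$, and an inversion $i \colon G \to G$, $i(g) = g^{-1}$, with $\epsilon(\alpha(g)) g = g = g\,\epsilon(\beta(g))$, $g g^{-1} = \epsilon(\alpha(g))$, $g^{-1} g = \epsilon(\beta(g))$. Translations: $\ell_g \colon \alpha^{-1}(\beta(g)) \to \alpha^{-1}(\alpha(g))$, $\ell_g(h) = gh$, and $r_g \colon \beta^{-1}(\alpha(g)) \to \beta^{-1}(\beta(g))$, $r_g(h) = hg$. The Lie algebroid $AG \to Q$ is the vector bundle with fibers $A_q G = \ker T_{\epsilon(q)} \alpha$, and $A^\ast G \to Q$ is the dual bundle. For a section $X \in \Gamma(AG)$, $\overleftarrow{X}(g) = T_{\epsilon(\beta(g))} \ell_g (X(\beta(g)))$ and $\overrightarrow{X}(g) = - T_{\epsilon(\alpha(g))}(r_g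 \circ i)(X(\alpha(g)))$. The cotangent groupoid $T^\ast G \rightrightarrows A^\ast G$ has source $\widetilde{\alpha}$ and target $\widetilde{\beta}$ given, for $\mu \in T_g^\ast G$, by $\widetilde{\alpha}(\mu) \in A^\ast_{\alpha(g)} G$, $\widetilde{\beta}(\mu) \in A^\ast_{\beta(g)} G$ with $\langle \widetilde{\alpha}(\mu), X(\alpha(g)) \rangle = \langle \mu, \overrightarrow{X}(g) \rangle$ and $\langle \widetilde{\beta}(\mu), X(\beta(g)) \rangle = \langle \mu, \overleftarrow{X}(g) \rangle$ for all $X \in \Gamma(AG)$. Primes denote the corresponding objects for $G' \rightrightarrows Q'$. A discrete constrained Lagrangian system $(G, N, L)$ consists of a Lie groupoid $G \rightrightarrows Q$, a submanifold $N \subset G$, and a (smooth) function $L \colon N \to \mathbb{R}$. Its associated Lagrangian submanifold of $T^\ast G$ is $$\Sigma_L = \{ p \in T^\ast G : \pi_G(p) \in N \text{ and } \langle p, v \rangle = \langle \mathrm{d}L, v \rangle \text{ for all } v \in T_{\pi_G(p)} N \},$$ where $\pi_G \colon T^\ast G \to G$ is the projection. A sequence $\mu_1, \ldots, \mu_n \in T^\ast G$ satisfies the discrete Lagrangian dynamics of $(G,N,L)$ if $\mu_1, \ldots, \mu_n \in \Sigma_L$ and $\widetilde{\beta}(\mu_k) = \widetilde{\alpha}(\mu_{k+1})$ for $k = 1, \ldots, n-1$. A smooth map $\Phi \colon G \to G'$ is a morphism of Lie groupoids if for every $(g,h) \in G_2$ one has $(\Phi(g), \Phi(h)) \in G'_2$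 and $\Phi(gh) = \Phi(g)\Phi(h)$. It is a morphism of discrete constrained Lagrangian systems $(G,N,L) \to (G',N',L')$ if in addition $N = \Phi^{-1}(N')$ and $L = L' \circ \Phi$ (on $N$). Covectors $\mu \in T_g^\ast G$ and $\mu' \in T^\ast_{\Phi(g)} G'$ are $\Phi^\ast$-related if $\langle \mu, v \rangle = \langle \mu', T\Phi(v) \rangle$ for all $v \in T_g G$.
   Formalization: Adds the hypothesis that the base points g_k of μ_k are composable, (g_k, g_{k+1}) ∈ G_2 for k = 1,…,n−1; without it the claim fails, e.g. for the pair groupoid of R mapping to the trivial groupoid over a point with L = L' = 0. *)

theory Defs
  imports "HOL-Analysis.Analysis"
begin

section \<open>Smooth functions on subsets of Euclidean spaces\<close>

primrec Ck_on :: "nat \<Rightarrow> ('e::euclidean_space \<Rightarrow> 'f::euclidean_space) \<Rightarrow> 'e set \<Rightarrow> bool" where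
  "Ck_on 0 f W \<longleftrightarrow> continuous_on W f"
| "Ck_on (Suc k) f W \<longleftrightarrow>
     (\<forall>x\<in>W. f differentiable (at x)) \<and> (\<forall>v. Ck_on k (\<lambda>x. frechet_derivative f (at x) v) W)"

text \<open>On a set that need not be open, smooth means: locally the restriction of a smooth
  function that is defined on an open set.\<close>

definition smooth_on :: "('e::euclidean_space \<Rightarrow> 'f::euclidean_space) \<Rightarrow> 'e set \<Rightarrow> bool" where
  "smooth_on f S \<longleftrightarrow>
     (\<forall>x\<in>S. \<exists>W g. open W \<and> x \<in> W \<and> (\<forall>k. Ck_on k g W) \<and> (\<forall>y\<in>S \<inter> W. f y = g y))"

section \<open>Smooth manifolds\<close>

text \<open>Charts take values in a linear subspace of a Euclidean space, the model space, and their
  images are open in it. With the model space \<open>UNIV\<close> one would lose the manifolds of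
  dimension 0 (such as the base of a Lie group), because every type of class
  \<open>euclidean_space\<close> has positive dimension.\<close>

type_synonym ('a, 'e) chart = "'a set \<times> ('a \<Rightarrow> 'e)"

record ('a, 'e) manifold =
  man_top :: "'a topology"
  man_model :: "'e set"
  man_atlas :: "('a, 'e) chart set"

abbreviation pts :: "('a, 'e) manifold \<Rightarrow> 'a set" where
  "pts M \<equiv> topspace (man_top M)"

definition top_chart :: "('a, 'e::euclidean_space) manifold \<Rightarrow> ('a, 'e) chart \<Rightarrow> bool" where
  "top_chart M c \<longleftrightarrow> (case c of (U, \<phi>) \<Rightarrow>
     openin (man_top M) U \<and>
     openin (top_of_set (man_model M)) (\<phi> ` U) \<and>
     homeomorphic_map (subtopology (man_top M) U) (top_of_set (\<phi> ` U)) \<phi>)"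

definition smooth_transition :: "('a, 'e::euclidean_space) chart \<Rightarrow> ('a, 'e) chart \<Rightarrow> bool" where
  "smooth_transition c d \<longleftrightarrow> (case c of (U, \<phi>) \<Rightarrow> case d of (V, \<psi>) \<Rightarrow>
     smooth_on (\<psi> \<circ> inv_into U \<phi>) (\<phi> ` (U \<inter> V)))"

definition smooth_manifold :: "('a, 'e::euclidean_space) manifold \<Rightarrow> bool" where
  "smooth_manifold M \<longleftrightarrow>
     Hausdorff_space (man_top M) \<and> second_countable (man_top M) \<and>
     subspace (man_model M) \<and>
     (\<forall>c\<in>man_atlas M. top_chart M c) \<and>
     (\<Union>c\<in>man_atlas M. fst c) = pts M \<and>
     (\<forall>c\<in>man_atlas M. \<forall>d\<in>man_atlas M. smooth_transition c d)"

text \<open>The charts of the maximal atlas.\<close>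

definition smooth_chart :: "('a, 'e::euclidean_space) manifold \<Rightarrow> ('a, 'e) chart \<Rightarrow> bool" where
  "smooth_chart M c \<longleftrightarrow>
     top_chart M c \<and> (\<forall>d\<in>man_atlas M. smooth_transition c d \<and> smooth_transition d c)"

definition real_line :: "(real, real) manifold" where
  "real_line = \<lparr>man_top = euclidean, man_model = UNIV, man_atlas = {(UNIV, id)}\<rparr>"

definition prod_manifold :: "('a, 'e) manifold \<Rightarrow> ('b, 'f) manifold \<Rightarrow> ('a \<times> 'b, 'e \<times> 'f) manifold"
  where
  "prod_manifold M M' =
     \<lparr>man_top = prod_topology (man_top M) (man_top M'),
      man_model = man_model M \<times> man_model M',
      man_atlas = {(U \<times> V, map_prod \<phi> \<psi>) | U \<phi> V \<psi>.
                     (U, \<phi>) \<in> man_atlas M \<and> (V, \<psi>) \<in> man_atlas M'}\<rparr>"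

text \<open>The maps between subsets of manifolds below are smooth in the sense of local smooth
  extensions; on an embedded submanifold \<open>S\<close> this is smoothness for the induced structure.\<close>

definition smooth_map_on ::
  "('a, 'e::euclidean_space) manifold \<Rightarrow> ('b, 'f::euclidean_space) manifold \<Rightarrow>
     'a set \<Rightarrow> ('a \<Rightarrow> 'b) \<Rightarrow> bool" where
  "smooth_map_on M M' S f \<longleftrightarrow>
     S \<subseteq> pts M \<and>
     continuous_map (subtopology (man_top M) S) (man_top M') f \<and>
     (\<forall>(U, \<phi>)\<in>man_atlas M. \<forall>(V, \<psi>)\<in>man_atlas M'.
        smooth_on (\<psi> \<circ> f \<circ> inv_into U \<phi>) (\<phi> ` {p \<in> U \<inter> S. f p \<in> V}))"

abbreviation smooth_map ::
  "('a, 'e::euclidean_space) manifold \<Rightarrow> ('b, 'f::euclidean_space) manifold \<Rightarrow>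
     ('a \<Rightarrow> 'b) \<Rightarrow> bool" where
  "smooth_map M M' f \<equiv> smooth_map_on M M' (pts M) f"

section \<open>Tangent vectors\<close>

text \<open>Each point \<open>p\<close> gets a preferred chart \<open>chart_at M p\<close>, and \<open>T\<^sub>p M\<close> is
  identified with the model space through the differential of this chart: an element of
  \<open>T\<^sub>p M\<close> is the vector of \<open>man_model M\<close> that represents it in the preferred chart
  at \<open>p\<close>.\<close>

definition chart_at :: "('a, 'e) manifold \<Rightarrow> 'a \<Rightarrow> ('a, 'e) chart" where
  "chart_at M p = (SOME c. c \<in> man_atlas M \<and> p \<in> fst c)"

abbreviation tangent_space :: "('a, 'e) manifold \<Rightarrow> 'a \<Rightarrow> 'e set" where
  "tangent_space M p \<equiv> man_model M"

text \<open>The tangent map at \<open>p\<close> of a map \<open>f\<close> that matters only on \<open>S\<close>. A derivative within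
  the image of \<open>S\<close> is determined only on the vectors tangent to \<open>S\<close>, so for an embedded
  submanifold \<open>S\<close> this is the tangent map of \<open>f\<close> restricted to \<open>S\<close>, and it must be
  applied to elements of \<open>T\<^sub>p S\<close> only. For \<open>S = pts M\<close> these are all elements of \<open>man_model M\<close>.\<close>

definition tangent_map_on ::
  "('a, 'e::euclidean_space) manifold \<Rightarrow> ('b, 'f::euclidean_space) manifold \<Rightarrow>
     'a set \<Rightarrow> ('a \<Rightarrow> 'b) \<Rightarrow> 'a \<Rightarrow> 'e \<Rightarrow> 'f" where
  "tangent_map_on M M' S f p =
     (case chart_at M p of (U, \<phi>) \<Rightarrow> case chart_at M' (f p) of (V, \<psi>) \<Rightarrow>
        frechet_derivative (\<psi> \<circ> f \<circ> inv_into U \<phi>) (at (\<phi> p) within \<phi> ` (U \<inter> S)))"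

abbreviation tangent_map ::
  "('a, 'e::euclidean_space) manifold \<Rightarrow> ('b, 'f::euclidean_space) manifold \<Rightarrow>
     ('a \<Rightarrow> 'b) \<Rightarrow> 'a \<Rightarrow> 'e \<Rightarrow> 'f" where
  "tangent_map M M' f p \<equiv> tangent_map_on M M' (pts M) f p"

definition submersion ::
  "('a, 'e::euclidean_space) manifold \<Rightarrow> ('b, 'f::euclidean_space) manifold \<Rightarrow>
     ('a \<Rightarrow> 'b) \<Rightarrow> bool" where
  "submersion M M' f \<longleftrightarrow>
     smooth_map M M' f \<and>
     (\<forall>p\<in>pts M. tangent_map M M' f p ` tangent_space M p = tangent_space M' (f p))"

text \<open>Embedded submanifolds, by slice charts.\<close>

definition submanifold :: "('a, 'e::euclidean_space) manifold \<Rightarrow> 'a set \<Rightarrow> bool" where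
  "submanifold M N \<longleftrightarrow>
     N \<subseteq> pts M \<and>
     (\<exists>k. \<forall>p\<in>N. \<exists>U \<phi> F. smooth_chart M (U, \<phi>) \<and> p \<in> U \<and>
        subspace F \<and> F \<subseteq> man_model M \<and> dim F = k \<and> \<phi> ` (U \<inter> N) = \<phi> ` U \<inter> F)"

text \<open>\<open>T\<^sub>p N\<close> as a subset of \<open>T\<^sub>p M\<close>: the velocities at time 0 of the smooth curves in
  \<open>N\<close> through \<open>p\<close>.\<close>

definition tangent_space_of :: "('a, 'e::euclidean_space) manifold \<Rightarrow> 'a set \<Rightarrow> 'a \<Rightarrow> 'e set" where
  "tangent_space_of M N p =
     {tangent_map_on real_line M {-r<..<r} c 0 1 | c r.
        r > 0 \<and> smooth_map_on real_line M {-r<..<r} c \<and> c ` {-r<..<r} \<subseteq> N \<and> c 0 = p}"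

text \<open>The linear functionals on a subspace \<open>V\<close>, given the value \<open>undefined\<close> outside
  \<open>V\<close> so that equality of functionals is equality on \<open>V\<close>.\<close>

definition dual_space :: "'e::real_vector set \<Rightarrow> ('e \<Rightarrow> real) set" where
  "dual_space V =
     {\<mu> \<in> extensional V. (\<forall>u\<in>V. \<forall>v\<in>V. \<mu> (u + v) = \<mu> u + \<mu> v) \<and>
                         (\<forall>t. \<forall>v\<in>V. \<mu> (t *\<^sub>R v) = t * \<mu> v)}"

text \<open>A covector carries its base point: the pair \<open>(p, \<mu>)\<close> is \<open>\<mu> \<in> T\<^sup>*\<^sub>p M\<close>, and \<open>fst\<close>
  is the projection of the cotangent bundle.\<close>

definition cotangent_bundle :: "('a, 'e::euclidean_space) manifold \<Rightarrow> ('a \<times> ('e \<Rightarrow> real)) set" where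
  "cotangent_bundle M = (SIGMA p:pts M. dual_space (tangent_space M p))"

section \<open>Lie groupoids\<close>

record ('g, 'e, 'q, 'd) groupoid =
  arr :: "('g, 'e) manifold"
  obj :: "('q, 'd) manifold"
  src :: "'g \<Rightarrow> 'q"
  tgt :: "'g \<Rightarrow> 'q"
  mul :: "'g \<Rightarrow> 'g \<Rightarrow> 'g"
  idt :: "'q \<Rightarrow> 'g"
  ivs :: "'g \<Rightarrow> 'g"

definition composable :: "('g, 'e, 'q, 'd) groupoid \<Rightarrow> ('g \<times> 'g) set" where
  "composable \<G> = {(g, h). g \<in> pts (arr \<G>) \<and> h \<in> pts (arr \<G>) \<and> tgt \<G> g = src \<G> h}"

definition lie_groupoid ::
  "('g, 'e::euclidean_space, 'q, 'd::euclidean_space) groupoid \<Rightarrow> bool" where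
  "lie_groupoid \<G> \<longleftrightarrow>
     smooth_manifold (arr \<G>) \<and> smooth_manifold (obj \<G>) \<and>
     submersion (arr \<G>) (obj \<G>) (src \<G>) \<and> submersion (arr \<G>) (obj \<G>) (tgt \<G>) \<and>
     smooth_map_on (prod_manifold (arr \<G>) (arr \<G>)) (arr \<G>) (composable \<G>) (\<lambda>(g, h). mul \<G> g h) \<and>
     smooth_map (obj \<G>) (arr \<G>) (idt \<G>) \<and>
     smooth_map (arr \<G>) (arr \<G>) (ivs \<G>) \<and>
     (\<forall>(g, h)\<in>composable \<G>. src \<G> (mul \<G> g h) = src \<G> g \<and> tgt \<G> (mul \<G> g h) = tgt \<G> h) \<and>
     (\<forall>g h k. (g, h) \<in> composable \<G> \<longrightarrow> (h, k) \<in> composable \<G> \<longrightarrow>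
        mul \<G> (mul \<G> g h) k = mul \<G> g (mul \<G> h k)) \<and>
     (\<forall>q\<in>pts (obj \<G>). src \<G> (idt \<G> q) = q \<and> tgt \<G> (idt \<G> q) = q) \<and>
     (\<forall>g\<in>pts (arr \<G>). mul \<G> (idt \<G> (src \<G> g)) g = g \<and> mul \<G> g (idt \<G> (tgt \<G> g)) = g) \<and>
     (\<forall>g\<in>pts (arr \<G>). src \<G> (ivs \<G> g) = tgt \<G> g \<and> tgt \<G> (ivs \<G> g) = src \<G> g) \<and>
     (\<forall>g\<in>pts (arr \<G>). mul \<G> g (ivs \<G> g) = idt \<G> (src \<G> g) \<and>
                        mul \<G> (ivs \<G> g) g = idt \<G> (tgt \<G> g))"

definition src_fiber :: "('g, 'e, 'q, 'd) groupoid \<Rightarrow> 'q \<Rightarrow> 'g set" where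
  "src_fiber \<G> q = {g \<in> pts (arr \<G>). src \<G> g = q}"

section \<open>The Lie algebroid and the cotangent groupoid\<close>

definition algebroid ::
  "('g, 'e::euclidean_space, 'q, 'd::euclidean_space) groupoid \<Rightarrow> 'q \<Rightarrow> 'e set" where
  "algebroid \<G> q =
     {v \<in> tangent_space (arr \<G>) (idt \<G> q).
        tangent_map (arr \<G>) (obj \<G>) (src \<G>) (idt \<G> q) v = 0}"

text \<open>The left translation \<open>\<ell>\<^sub>g\<close> and the map \<open>r\<^sub>g \<circ> i\<close> are both defined on source fibers. The
  vector \<open>a\<close> is in the fiber of the algebroid over \<open>tgt \<G> g\<close>, respectively
  \<open>src \<G> g\<close>, and the resulting vector is in \<open>T\<^sub>g G\<close>.\<close>

definition left_vec ::
  "('g, 'e::euclidean_space, 'q, 'd::euclidean_space) groupoid \<Rightarrow> 'g \<Rightarrow> 'e \<Rightarrow> 'e" where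
  "left_vec \<G> g a =
     tangent_map_on (arr \<G>) (arr \<G>) (src_fiber \<G> (tgt \<G> g)) (\<lambda>h. mul \<G> g h)
       (idt \<G> (tgt \<G> g)) a"

definition right_vec ::
  "('g, 'e::euclidean_space, 'q, 'd::euclidean_space) groupoid \<Rightarrow> 'g \<Rightarrow> 'e \<Rightarrow> 'e" where
  "right_vec \<G> g a =
     - tangent_map_on (arr \<G>) (arr \<G>) (src_fiber \<G> (src \<G> g)) (\<lambda>h. mul \<G> (ivs \<G> h) g)
         (idt \<G> (src \<G> g)) a"

text \<open>Smooth sections of the algebroid. In the preferred chart at \<open>idt \<G> q\<close> the value of the
  section at \<open>q\<close> is \<open>X q\<close>; to express smoothness it is transformed to a chart \<open>(V, \<psi>)\<close> that
  does not depend on \<open>q\<close>.\<close>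

definition vec_in_chart ::
  "('a, 'e::euclidean_space) manifold \<Rightarrow> ('a, 'e) chart \<Rightarrow> 'a \<Rightarrow> 'e \<Rightarrow> 'e" where
  "vec_in_chart M c p v =
     (case c of (V, \<psi>) \<Rightarrow> case chart_at M p of (U, \<phi>) \<Rightarrow>
        frechet_derivative (\<psi> \<circ> inv_into U \<phi>) (at (\<phi> p) within \<phi> ` U) v)"

definition algebroid_sections ::
  "('g, 'e::euclidean_space, 'q, 'd::euclidean_space) groupoid \<Rightarrow> ('q \<Rightarrow> 'e) set" where
  "algebroid_sections \<G> =
     {X. (\<forall>q\<in>pts (obj \<G>). X q \<in> algebroid \<G> q) \<and>
         (\<forall>(U, \<phi>)\<in>man_atlas (obj \<G>). \<forall>(V, \<psi>)\<in>man_atlas (arr \<G>).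
            smooth_on ((\<lambda>q. vec_in_chart (arr \<G>) (V, \<psi>) (idt \<G> q) (X q)) \<circ> inv_into U \<phi>)
                      (\<phi> ` {q \<in> U. idt \<G> q \<in> V}))}"

definition left_field ::
  "('g, 'e::euclidean_space, 'q, 'd::euclidean_space) groupoid \<Rightarrow> ('q \<Rightarrow> 'e) \<Rightarrow> 'g \<Rightarrow> 'e" where
  "left_field \<G> X g = left_vec \<G> g (X (tgt \<G> g))"

definition right_field ::
  "('g, 'e::euclidean_space, 'q, 'd::euclidean_space) groupoid \<Rightarrow> ('q \<Rightarrow> 'e) \<Rightarrow> 'g \<Rightarrow> 'e" where
  "right_field \<G> X g = right_vec \<G> g (X (src \<G> g))"

text \<open>Source and target of the cotangent groupoid. An element of the dual bundle of the algebroid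
  is a pair of a base point \<open>q\<close> and a functional on \<open>algebroid \<G> q\<close>. The
  invariant vector field of a section \<open>X\<close> depends at \<open>g\<close> only on the value of \<open>X\<close> at
  \<open>src \<G> g\<close>, respectively \<open>tgt \<G> g\<close>, so the pairing is written for that value; the
  equations for sections are the lemmas \<open>cot_src_section\<close> and \<open>cot_tgt_section\<close>.\<close>

definition cot_src ::
  "('g, 'e::euclidean_space, 'q, 'd::euclidean_space) groupoid \<Rightarrow>
     'g \<times> ('e \<Rightarrow> real) \<Rightarrow> 'q \<times> ('e \<Rightarrow> real)" where
  "cot_src \<G> = (\<lambda>(g, \<mu>).
     (src \<G> g, restrict (\<lambda>a. \<mu> (right_vec \<G> g a)) (algebroid \<G> (src \<G> g))))"

definition cot_tgt ::
  "('g, 'e::euclidean_space, 'q, 'd::euclidean_space) groupoid \<Rightarrow>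
     'g \<times> ('e \<Rightarrow> real) \<Rightarrow> 'q \<times> ('e \<Rightarrow> real)" where
  "cot_tgt \<G> = (\<lambda>(g, \<mu>).
     (tgt \<G> g, restrict (\<lambda>a. \<mu> (left_vec \<G> g a)) (algebroid \<G> (tgt \<G> g))))"

lemma lie_groupoid_src_tgt_in:
  assumes "lie_groupoid \<G>" "g \<in> pts (arr \<G>)"
  shows "src \<G> g \<in> pts (obj \<G>)" "tgt \<G> g \<in> pts (obj \<G>)"
  using assms
  by (auto simp: lie_groupoid_def submersion_def smooth_map_on_def continuous_map_def)

lemma cot_src_section:
  assumes "lie_groupoid \<G>" "(g, \<mu>) \<in> cotangent_bundle (arr \<G>)" "X \<in> algebroid_sections \<G>"
  shows "snd (cot_src \<G> (g, \<mu>)) (X (src \<G> g)) = \<mu> (right_field \<G> X g)"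
  using assms lie_groupoid_src_tgt_in[OF assms(1), of g]
  by (auto simp: cot_src_def right_field_def algebroid_sections_def cotangent_bundle_def)

lemma cot_tgt_section:
  assumes "lie_groupoid \<G>" "(g, \<mu>) \<in> cotangent_bundle (arr \<G>)" "X \<in> algebroid_sections \<G>"
  shows "snd (cot_tgt \<G> (g, \<mu>)) (X (tgt \<G> g)) = \<mu> (left_field \<G> X g)"
  using assms lie_groupoid_src_tgt_in[OF assms(1), of g]
  by (auto simp: cot_tgt_def left_field_def algebroid_sections_def cotangent_bundle_def)

section \<open>Discrete constrained Lagrangian systems\<close>

definition lagrangian_system ::
  "('g, 'e::euclidean_space, 'q, 'd::euclidean_space) groupoid \<Rightarrow> 'g set \<Rightarrow> ('g \<Rightarrow> real) \<Rightarrow> bool"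
  where
  "lagrangian_system \<G> N L \<longleftrightarrow>
     lie_groupoid \<G> \<and> submanifold (arr \<G>) N \<and> smooth_map_on (arr \<G>) real_line N L"

definition lagrangian_submanifold ::
  "('g, 'e::euclidean_space, 'q, 'd::euclidean_space) groupoid \<Rightarrow> 'g set \<Rightarrow> ('g \<Rightarrow> real) \<Rightarrow>
     ('g \<times> ('e \<Rightarrow> real)) set" where
  "lagrangian_submanifold \<G> N L =
     {(g, \<mu>) \<in> cotangent_bundle (arr \<G>). g \<in> N \<and>
        (\<forall>v\<in>tangent_space_of (arr \<G>) N g. \<mu> v = tangent_map_on (arr \<G>) real_line N L g v)}"

definition discrete_dynamics ::
  "('g, 'e::euclidean_space, 'q, 'd::euclidean_space) groupoid \<Rightarrow> 'g set \<Rightarrow> ('g \<Rightarrow> real) \<Rightarrow>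
     nat \<Rightarrow> (nat \<Rightarrow> 'g \<times> ('e \<Rightarrow> real)) \<Rightarrow> bool" where
  "discrete_dynamics \<G> N L n \<mu> \<longleftrightarrow>
     (\<forall>k\<in>{1..n}. \<mu> k \<in> lagrangian_submanifold \<G> N L) \<and>
     (\<forall>k\<in>{1..<n}. cot_tgt \<G> (\<mu> k) = cot_src \<G> (\<mu> (k + 1)))"

text \<open>The base points of a solution form a composable sequence.\<close>

lemma discrete_dynamics_composable:
  assumes "discrete_dynamics \<G> N L n \<mu>" "k \<in> {1..<n}"
  shows "(fst (\<mu> k), fst (\<mu> (k + 1))) \<in> composable \<G>"
proof -
  have "k \<in> {1..n}" "k + 1 \<in> {1..n}" using assms(2) by auto
  with assms(1) have "\<mu> k \<in> lagrangian_submanifold \<G> N L" "\<mu> (k + 1) \<in> lagrangian_submanifold \<G> N L"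
    unfolding discrete_dynamics_def by blast+
  moreover have "cot_tgt \<G> (\<mu> k) = cot_src \<G> (\<mu> (k + 1))"
    using assms unfolding discrete_dynamics_def by blast
  ultimately show ?thesis
    by (auto simp: lagrangian_submanifold_def cotangent_bundle_def composable_def
        cot_src_def cot_tgt_def split: prod.splits)
qed

definition groupoid_morphism ::
  "('g, 'e::euclidean_space, 'q, 'd::euclidean_space) groupoid \<Rightarrow>
   ('h, 'f::euclidean_space, 'r, 'c::euclidean_space) groupoid \<Rightarrow> ('g \<Rightarrow> 'h) \<Rightarrow> bool" where
  "groupoid_morphism \<G> \<G>' \<Phi> \<longleftrightarrow>
     smooth_map (arr \<G>) (arr \<G>') \<Phi> \<and>
     (\<forall>(g, h)\<in>composable \<G>. (\<Phi> g, \<Phi> h) \<in> composable \<G>' \<and>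
        \<Phi> (mul \<G> g h) = mul \<G>' (\<Phi> g) (\<Phi> h))"

definition lagrangian_morphism ::
  "('g, 'e::euclidean_space, 'q, 'd::euclidean_space) groupoid \<Rightarrow> 'g set \<Rightarrow> ('g \<Rightarrow> real) \<Rightarrow>
   ('h, 'f::euclidean_space, 'r, 'c::euclidean_space) groupoid \<Rightarrow> 'h set \<Rightarrow> ('h \<Rightarrow> real) \<Rightarrow>
   ('g \<Rightarrow> 'h) \<Rightarrow> bool" where
  "lagrangian_morphism \<G> N L \<G>' N' L' \<Phi> \<longleftrightarrow>
     groupoid_morphism \<G> \<G>' \<Phi> \<and>
     N = {g \<in> pts (arr \<G>). \<Phi> g \<in> N'} \<and>
     (\<forall>g\<in>N. L g = L' (\<Phi> g))"

definition covectors_related ::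
  "('a, 'e::euclidean_space) manifold \<Rightarrow> ('b, 'f::euclidean_space) manifold \<Rightarrow> ('a \<Rightarrow> 'b) \<Rightarrow>
     'a \<times> ('e \<Rightarrow> real) \<Rightarrow> 'b \<times> ('f \<Rightarrow> real) \<Rightarrow> bool" where
  "covectors_related M M' \<Phi> = (\<lambda>(p, \<mu>) (p', \<mu>').
     p' = \<Phi> p \<and> (\<forall>v\<in>tangent_space M p. \<mu> v = \<mu>' (tangent_map M M' \<Phi> p v)))"

end

theory Submission
  imports Defs
begin

text \<open>Both clauses of the discrete dynamics are pairings of covectors with vectors, so the
  theorem follows once \<open>T\<Phi>\<close> is known to carry the vectors that are paired on \<open>G\<close> to those that
  are paired on \<open>G'\<close>; a relation \<open>\<mu> = \<Phi>\<^sup>*\<mu>'\<close> then transports each equation from \<open>G'\<close> back to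
  \<open>G\<close>.

  For the first clause, \<open>\<Phi>\<close> maps \<open>N\<close> into \<open>N'\<close> and \<open>L = L' \<circ> \<Phi>\<close>, hence
  \<open>\<langle>\<mu>, v\<rangle> = \<langle>\<mu>', T\<Phi> v\<rangle> = dL' (T\<Phi> v) = dL v\<close> for \<open>v\<close> tangent to \<open>N\<close>
  (\<open>related_lagrangian_submanifold\<close>). For the second, differentiating
  \<open>\<Phi>(g h) = \<Phi>(g) \<Phi>(h)\<close> and \<open>\<Phi>(h\<^sup>-\<^sup>1 g) = \<Phi>(h)\<^sup>-\<^sup>1 \<Phi>(g)\<close> in \<open>h\<close> at an identity shows that
  \<open>T\<Phi>\<close> maps the invariant vectors of \<open>a\<close> at \<open>g\<close> to those of \<open>T\<Phi> a\<close> at \<open>\<Phi>(g)\<close>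
  (\<open>morphism_left_vec\<close>, \<open>morphism_right_vec\<close>). If \<open>\<mu>\<close> lies over \<open>g\<close>, \<open>\<eta>\<close> over \<open>h\<close> and \<open>g h\<close> is
  defined, the target of \<open>\<mu>\<close> and the source of \<open>\<eta>\<close> are functionals on the same fiber, and
  their values at \<open>a\<close> are the values at the one vector \<open>T\<Phi> a\<close> of the corresponding functionals
  on \<open>G'\<close> (\<open>related_cot_tgt_eq_cot_src\<close>).

  The differential of \<open>L\<close> and the invariant vectors are derivatives within a set that is not open,
  namely \<open>N\<close> or a source fiber. Such a derivative is determined only on velocities of curves in the set.
  Every identity between tangent vectors is therefore proved by exhibiting a curve and computing
  its velocity in two ways: maps send velocities to velocities (\<open>has_velocity_push\<close>) and a curve
  has at most one velocity (\<open>has_velocity_unique\<close>). Vectors tangent to \<open>N\<close> are velocities of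
  curves in \<open>N\<close> by definition. Elements of the algebroid are merely defined by \<open>T\<alpha> a = 0\<close>;
  that they are velocities of curves in a source fiber is the regular level set theorem for the
  submersion \<open>\<alpha>\<close> (\<open>submersion_kernel_velocity\<close>), which rests on the inverse function theorem.
  Curves that are differentiable at time 0 suffice for this. Smoothness is
  needed of the curve \<open>\<Phi> \<circ> c\<close> in \<open>N'\<close>, by the definition of tangent vectors of \<open>N'\<close>, and of the
  translations; both follow from the closure of smooth maps under composition.\<close>

section \<open>Calculus of functions of class \<open>C\<^sup>k\<close>\<close>

text \<open>The derivatives are taken at the points of an open set, so they only see the values there.\<close>

lemma Ck_on_cong:
  assumes "open W" "\<And>x. x \<in> W \<Longrightarrow> f x = g x"
  shows "Ck_on k f W \<longleftrightarrow> Ck_on k g W"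
  using assms
proof (induction k arbitrary: f g)
  case 0
  then show ?case by (simp cong: continuous_on_cong)
next
  case (Suc k)
  have der: "(f has_derivative D) (at x) \<longleftrightarrow> (g has_derivative D) (at x)" if "x \<in> W" for x D
    using has_derivative_transform_within_open[OF _ Suc.prems(1) that, of f D UNIV g]
      has_derivative_transform_within_open[OF _ Suc.prems(1) that, of g D UNIV f] Suc.prems(2)
    by auto
  have "frechet_derivative f (at x) = frechet_derivative g (at x)" if "x \<in> W" for x
    unfolding frechet_derivative_def using der[OF that] by simp
  then have "Ck_on k (\<lambda>x. frechet_derivative f (at x) v) W \<longleftrightarrow>
      Ck_on k (\<lambda>x. frechet_derivative g (at x) v) W" for v
    using Suc.IH[OF Suc.prems(1)] by presburger
  moreover have "f differentiable (at x) \<longleftrightarrow> g differentiable (at x)" if "x \<in> W" for x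
    using der[OF that] by (simp add: differentiable_def)
  ultimately show ?case by auto
qed

lemma Ck_on_SucI:
  assumes "open W" "\<And>x. x \<in> W \<Longrightarrow> (f has_derivative D x) (at x)"
    and "\<And>v. Ck_on k (\<lambda>x. D x v) W"
  shows "Ck_on (Suc k) f W"
proof -
  have "D x = frechet_derivative f (at x)" if "x \<in> W" for x
    using assms(2)[OF that] by (rule frechet_derivative_at)
  then have "Ck_on k (\<lambda>x. frechet_derivative f (at x) v) W" for v
    using Ck_on_cong[OF assms(1), of "\<lambda>x. D x v" "\<lambda>x. frechet_derivative f (at x) v" k] assms(3)
    by simp
  then show ?thesis
    using assms(2) by (auto simp: differentiable_def)
qed

lemma Ck_on_Suc_has_derivative:
  assumes "Ck_on (Suc k) f W" "x \<in> W"
  shows "(f has_derivative frechet_derivative f (at x)) (at x)"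
  using assms by (simp flip: frechet_derivative_works)

lemma Ck_on_Suc_D: "Ck_on (Suc k) f W \<Longrightarrow> Ck_on k (\<lambda>x. frechet_derivative f (at x) v) W"
  by simp

lemma Ck_on_continuous:
  assumes "Ck_on k f W"
  shows "continuous_on W f"
proof (cases k)
  case 0
  then show ?thesis using assms by simp
next
  case (Suc l)
  then show ?thesis
    using assms by (auto simp: differentiable_on_def differentiable_at_withinI
        intro: differentiable_imp_continuous_on)
qed

lemma Ck_on_lower: "Ck_on (Suc k) f W \<Longrightarrow> Ck_on k f W"
proof (induction k arbitrary: f)
  case 0
  then show ?case using Ck_on_continuous[of "Suc 0"] by simp
next
  case (Suc k)
  then show ?case by (metis Ck_on.simps(2))
qed

lemma Ck_on_subset: "Ck_on k f W \<Longrightarrow> W' \<subseteq> W \<Longrightarrow> Ck_on k f W'"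
  by (induction k arbitrary: f) (auto intro: continuous_on_subset)

lemma Ck_on_const: "open W \<Longrightarrow> Ck_on k (\<lambda>x. c) W"
proof (induction k arbitrary: c)
  case (Suc k)
  then show ?case by (intro Ck_on_SucI[where D = "\<lambda>x v. 0"]) auto
qed simp

lemma Ck_on_id: "open W \<Longrightarrow> Ck_on k (\<lambda>x. x) W"
proof (cases k)
  case (Suc l)
  assume "open W"
  then show ?thesis unfolding Suc
    by (intro Ck_on_SucI[where D = "\<lambda>x v. v"]) (auto intro: Ck_on_const)
qed simp

lemma Ck_on_add:
  assumes "open W" "Ck_on k f W" "Ck_on k g W"
  shows "Ck_on k (\<lambda>x. f x + g x) W"
  using assms(2,3)
proof (induction k arbitrary: f g)
  case (Suc k)
  show ?case
  proof (rule Ck_on_SucI[OF assms(1)])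
    show "((\<lambda>x. f x + g x) has_derivative
        (\<lambda>v. frechet_derivative f (at x) v + frechet_derivative g (at x) v)) (at x)"
      if "x \<in> W" for x
      using that by (intro has_derivative_add Suc.prems[THEN Ck_on_Suc_has_derivative])
    show "Ck_on k (\<lambda>x. frechet_derivative f (at x) v + frechet_derivative g (at x) v) W" for v
      by (intro Suc.IH Suc.prems[THEN Ck_on_Suc_D])
  qed
qed (auto intro: continuous_on_add)

lemma Ck_on_sum:
  assumes "open W" "\<And>i. i \<in> I \<Longrightarrow> Ck_on k (f i) W"
  shows "Ck_on k (\<lambda>x. \<Sum>i\<in>I. f i x) W"
  using assms
  by (induction I rule: infinite_finite_induct) (auto intro: Ck_on_const Ck_on_add)

lemma Ck_on_bilinear:
  assumes "bounded_bilinear B" "open W" "Ck_on k f W" "Ck_on k g W"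
  shows "Ck_on k (\<lambda>x. B (f x) (g x)) W"
  using assms(3-)
proof (induction k arbitrary: f g)
  case 0
  then show ?case
    using bounded_bilinear.continuous_on[OF assms(1)] by simp
next
  case (Suc k)
  let ?Df = "\<lambda>x. frechet_derivative f (at x)"
  let ?Dg = "\<lambda>x. frechet_derivative g (at x)"
  show ?case
  proof (rule Ck_on_SucI[OF assms(2)])
    show "((\<lambda>x. B (f x) (g x)) has_derivative (\<lambda>v. B (f x) (?Dg x v) + B (?Df x v) (g x))) (at x)"
      if "x \<in> W" for x
      using that
      by (intro bounded_bilinear.FDERIV[OF assms(1)] Suc.prems[THEN Ck_on_Suc_has_derivative])
    show "Ck_on k (\<lambda>x. B (f x) (?Dg x v) + B (?Df x v) (g x)) W" for v
      by (intro Ck_on_add[OF assms(2)] Suc.IH Suc.prems[THEN Ck_on_Suc_D]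
          Suc.prems[THEN Ck_on_lower])
  qed
qed

text \<open>Expanding the inner derivative in a basis turns the chain rule into a finite sum of
  products, whose factors are of class \<open>C\<^sup>k\<close> by induction.\<close>

lemma Ck_on_compose:
  fixes f :: "'a::euclidean_space \<Rightarrow> 'b::euclidean_space"
    and g :: "'b \<Rightarrow> 'c::euclidean_space"
  assumes "open W" "open W'" "f ` W \<subseteq> W'" "Ck_on k f W" "Ck_on k g W'"
  shows "Ck_on k (\<lambda>x. g (f x)) W"
  using assms(4-)
proof (induction k arbitrary: g)
  case 0
  then show ?case using assms(3) by (auto intro: continuous_on_compose2)
next
  case (Suc k)
  show ?case
  proof (rule Ck_on_SucI[OF assms(1)])
    let ?Df = "\<lambda>x. frechet_derivative f (at x)"
    let ?Dg = "\<lambda>y. frechet_derivative g (at y)"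
    fix x assume x: "x \<in> W"
    have lin: "linear (?Dg (f x))"
      using has_derivative_linear[OF Ck_on_Suc_has_derivative[OF Suc.prems(2)]] x assms(3)
      by blast
    have "((\<lambda>x. g (f x)) has_derivative (\<lambda>v. ?Dg (f x) (?Df x v))) (at x)"
      using x assms(3) has_derivative_compose[OF Ck_on_Suc_has_derivative[OF Suc.prems(1)]
          Ck_on_Suc_has_derivative[OF Suc.prems(2)]] by blast
    moreover have "?Dg (f x) u = (\<Sum>b\<in>Basis. (u \<bullet> b) *\<^sub>R ?Dg (f x) b)" for u
      using linear_sum[OF lin, of "\<lambda>b. (u \<bullet> b) *\<^sub>R b" Basis]
      by (simp add: euclidean_representation linear_cmul[OF lin])
    then have "(\<lambda>v. ?Dg (f x) (?Df x v)) = (\<lambda>v. \<Sum>b\<in>Basis. (?Df x v \<bullet> b) *\<^sub>R ?Dg (f x) b)"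
      by (rule ext)
    ultimately show "((\<lambda>x. g (f x)) has_derivative
        (\<lambda>v. \<Sum>b\<in>Basis. (?Df x v \<bullet> b) *\<^sub>R ?Dg (f x) b)) (at x)"
      by (simp only:)
  next
    have "Ck_on k (\<lambda>x. frechet_derivative g (at (f x)) b) W" for b
      using Ck_on_lower[OF Suc.prems(1)] Ck_on_Suc_D[OF Suc.prems(2)] by (rule Suc.IH)
    moreover have "Ck_on k (\<lambda>x. frechet_derivative f (at x) v \<bullet> b) W" for v b
      using assms(1) Ck_on_Suc_D[OF Suc.prems(1)] Ck_on_const[OF assms(1)]
      by (rule Ck_on_bilinear[OF bounded_bilinear_inner])
    ultimately show "Ck_on k (\<lambda>x. \<Sum>b\<in>Basis. (frechet_derivative f (at x) v \<bullet> b) *\<^sub>R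
        frechet_derivative g (at (f x)) b) W" for v
      by (intro Ck_on_sum[OF assms(1)] Ck_on_bilinear[OF bounded_bilinear_scaleR assms(1)])
  qed
qed

lemma Ck_on_Pair:
  assumes "open W" "Ck_on k f W" "Ck_on k g W"
  shows "Ck_on k (\<lambda>x. (f x, g x)) W"
  using assms(2,3)
proof (induction k arbitrary: f g)
  case (Suc k)
  show ?case
  proof (rule Ck_on_SucI[OF assms(1)])
    show "((\<lambda>x. (f x, g x)) has_derivative
        (\<lambda>v. (frechet_derivative f (at x) v, frechet_derivative g (at x) v))) (at x)"
      if "x \<in> W" for x
      using that by (intro has_derivative_Pair Suc.prems[THEN Ck_on_Suc_has_derivative])
    show "Ck_on k (\<lambda>x. (frechet_derivative f (at x) v, frechet_derivative g (at x) v)) W" for v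
      by (intro Suc.IH Suc.prems[THEN Ck_on_Suc_D])
  qed
qed (auto intro: continuous_on_Pair)

section \<open>Smooth maps between subsets of manifolds\<close>

lemma smooth_onE:
  assumes "smooth_on f S" "x \<in> S"
  obtains W g where "open W" "x \<in> W" "\<And>k. Ck_on k g W" "\<And>y. y \<in> S \<Longrightarrow> y \<in> W \<Longrightarrow> f y = g y"
proof -
  from assms obtain W g where "open W" "x \<in> W" "\<forall>k. Ck_on k g W" "\<forall>y\<in>S \<inter> W. f y = g y"
    unfolding smooth_on_def by meson
  then show thesis by (intro that[of W g]) auto
qed

lemma smooth_on_subset: "smooth_on f S \<Longrightarrow> S' \<subseteq> S \<Longrightarrow> smooth_on f S'"
  unfolding smooth_on_def
proof
  fix x assume "\<forall>x\<in>S. \<exists>W g. open W \<and> x \<in> W \<and> (\<forall>k. Ck_on k g W) \<and> (\<forall>y\<in>S \<inter> W. f y = g y)"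
    and "S' \<subseteq> S" "x \<in> S'"
  then obtain W g where "open W" "x \<in> W" "\<forall>k. Ck_on k g W" "\<forall>y\<in>S \<inter> W. f y = g y"
    by (meson subsetD)
  then show "\<exists>W g. open W \<and> x \<in> W \<and> (\<forall>k. Ck_on k g W) \<and> (\<forall>y\<in>S' \<inter> W. f y = g y)"
    using \<open>S' \<subseteq> S\<close> by (intro exI[of _ W] exI[of _ g]) auto
qed

lemma smooth_on_Ck: "(\<And>k. Ck_on k f UNIV) \<Longrightarrow> smooth_on f S"
  unfolding smooth_on_def by (intro ballI exI[of _ UNIV] exI[of _ f]) auto

lemma smooth_on_Pair:
  assumes "smooth_on f S" "smooth_on g S"
  shows "smooth_on (\<lambda>x. (f x, g x)) S"
  unfolding smooth_on_def
proof
  fix x assume x: "x \<in> S"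
  obtain W1 f1 where 1: "open W1" "x \<in> W1" "\<And>k. Ck_on k f1 W1" "\<And>y. y \<in> S \<Longrightarrow> y \<in> W1 \<Longrightarrow> f y = f1 y"
    using smooth_onE[OF assms(1) x] by metis
  obtain W2 g1 where 2: "open W2" "x \<in> W2" "\<And>k. Ck_on k g1 W2" "\<And>y. y \<in> S \<Longrightarrow> y \<in> W2 \<Longrightarrow> g y = g1 y"
    using smooth_onE[OF assms(2) x] by metis
  have "Ck_on k (\<lambda>x. (f1 x, g1 x)) (W1 \<inter> W2)" for k
    using 1 2 by (intro Ck_on_Pair Ck_on_subset[OF 1(3)] Ck_on_subset[OF 2(3)]) auto
  then show "\<exists>W g'. open W \<and> x \<in> W \<and> (\<forall>k. Ck_on k g' W) \<and> (\<forall>y\<in>S \<inter> W. (f y, g y) = g' y)"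
    using 1 2 by (intro exI[of _ "W1 \<inter> W2"] exI[of _ "\<lambda>x. (f1 x, g1 x)"]) auto
qed

text \<open>What a composition of smooth maps needs of the manifold in the middle. It is weaker than being a
  smooth manifold and passes to products without any discussion of transition maps; the
  multiplication of a groupoid is defined on a subset of a product.\<close>

definition covered_by_charts :: "('a, 'e) manifold \<Rightarrow> bool" where
  "covered_by_charts M \<longleftrightarrow>
     (\<forall>(U, \<phi>)\<in>man_atlas M. openin (man_top M) U \<and> inj_on \<phi> U) \<and>
     pts M \<subseteq> (\<Union>c\<in>man_atlas M. fst c)"

lemma covered_by_chartsE:
  assumes "covered_by_charts M" "p \<in> pts M"
  obtains U \<phi> where "(U, \<phi>) \<in> man_atlas M" "p \<in> U" "openin (man_top M) U" "inj_on \<phi> U"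
proof -
  from assms obtain c where "c \<in> man_atlas M" "p \<in> fst c"
    unfolding covered_by_charts_def by blast
  then show thesis
    using assms(1) that[of "fst c" "snd c"] unfolding covered_by_charts_def by force
qed

lemma chart_inj:
  assumes "smooth_manifold M" "(U, \<phi>) \<in> man_atlas M"
  shows "inj_on \<phi> U"
proof -
  have "top_chart M (U, \<phi>)" using assms by (auto simp: smooth_manifold_def)
  then have o: "openin (man_top M) U"
    and h: "homeomorphic_map (subtopology (man_top M) U) (top_of_set (\<phi> ` U)) \<phi>"
    by (auto simp: top_chart_def)
  have "topspace (subtopology (man_top M) U) = U"
    using openin_subset[OF o] by auto
  then show ?thesis using h by (simp add: homeomorphic_eq_everything_map)
qed

lemma chart_open:
  assumes "smooth_manifold M" "(U, \<phi>) \<in> man_atlas M"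
  shows "openin (man_top M) U" "openin (top_of_set (man_model M)) (\<phi> ` U)"
  using assms by (auto simp: smooth_manifold_def top_chart_def)

text \<open>A chart is open onto its image, so an open set of the manifold is cut out in the chart by an
  open set \<open>T\<close> of the model Euclidean space, although the image itself is open only in the model
  subspace.\<close>

lemma chart_open_image:
  assumes "smooth_manifold M" "(U, \<phi>) \<in> man_atlas M" "openin (man_top M) Y"
  obtains T where "open T" "\<And>p. p \<in> U \<Longrightarrow> \<phi> p \<in> T \<longleftrightarrow> p \<in> Y"
proof -
  have "top_chart M (U, \<phi>)" using assms by (auto simp: smooth_manifold_def)
  then have "open_map (subtopology (man_top M) U) (top_of_set (\<phi> ` U)) \<phi>"
    by (auto simp: top_chart_def homeomorphic_imp_open_map)
  moreover have "openin (subtopology (man_top M) U) (U \<inter> Y)"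
    using assms(3) by (simp add: openin_subtopology_Int2)
  ultimately have "openin (top_of_set (\<phi> ` U)) (\<phi> ` (U \<inter> Y))"
    by (auto simp: open_map_def)
  then obtain T where "open T" "\<phi> ` (U \<inter> Y) = \<phi> ` U \<inter> T"
    by (auto simp: openin_open)
  moreover have "\<phi> p \<in> T \<longleftrightarrow> p \<in> Y" if "p \<in> U" for p
    using chart_inj[OF assms(1,2)] calculation(2) that
    by (metis IntD2 IntI imageI inj_on_image_mem_iff inf_le1)
  ultimately show ?thesis using that by blast
qed

lemma smooth_manifold_covered: "smooth_manifold M \<Longrightarrow> covered_by_charts M"
  using chart_inj[of M] chart_open(1)[of M]
  by (auto simp: covered_by_charts_def smooth_manifold_def)

lemma prod_manifold_covered:
  assumes "covered_by_charts M" "covered_by_charts M'"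
  shows "covered_by_charts (prod_manifold M M')"
  unfolding covered_by_charts_def
proof
  show "\<forall>(U, \<phi>)\<in>man_atlas (prod_manifold M M').
      openin (man_top (prod_manifold M M')) U \<and> inj_on \<phi> U"
    using assms by (fastforce simp: covered_by_charts_def prod_manifold_def
        openin_prod_Times_iff intro: map_prod_inj_on)
  show "pts (prod_manifold M M') \<subseteq> (\<Union>c\<in>man_atlas (prod_manifold M M'). fst c)"
  proof
    fix x assume "x \<in> pts (prod_manifold M M')"
    then have x: "fst x \<in> pts M" "snd x \<in> pts M'" by (auto simp: prod_manifold_def)
    obtain U \<phi> where "(U, \<phi>) \<in> man_atlas M" "fst x \<in> U"
      using covered_by_chartsE[OF assms(1) x(1)] by metis
    moreover obtain V \<psi> where "(V, \<psi>) \<in> man_atlas M'" "snd x \<in> V"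
      using covered_by_chartsE[OF assms(2) x(2)] by metis
    ultimately have "(U \<times> V, map_prod \<phi> \<psi>) \<in> man_atlas (prod_manifold M M')" "x \<in> U \<times> V"
      by (auto simp: prod_manifold_def mem_Times_iff)
    then show "x \<in> (\<Union>c\<in>man_atlas (prod_manifold M M'). fst c)" by force
  qed
qed

lemma smooth_map_onD:
  assumes "smooth_map_on M M' S f" "(U, \<phi>) \<in> man_atlas M" "(V, \<psi>) \<in> man_atlas M'"
  shows "smooth_on (\<psi> \<circ> f \<circ> inv_into U \<phi>) (\<phi> ` {p \<in> U \<inter> S. f p \<in> V})"
  using assms unfolding smooth_map_on_def by blast

lemma smooth_map_on_image: "smooth_map_on M M' S f \<Longrightarrow> p \<in> S \<Longrightarrow> f p \<in> pts M'"
  by (auto simp: smooth_map_on_def continuous_map_def)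

lemma smooth_map_on_subset:
  assumes "smooth_map_on M M' S f" "S' \<subseteq> S"
  shows "smooth_map_on M M' S' f"
proof -
  have "continuous_map (subtopology (man_top M) S') (man_top M') f"
    using assms continuous_map_from_subtopology_mono unfolding smooth_map_on_def by blast
  then show ?thesis
    using assms unfolding smooth_map_on_def
    by (fastforce elim!: smooth_on_subset)
qed

lemma smooth_map_on_preimage:
  assumes "smooth_manifold M" "(U, \<phi>) \<in> man_atlas M"
    and "smooth_map_on M M' S f" "openin (man_top M') V"
  obtains T where "open T" "\<And>p. p \<in> U \<inter> S \<Longrightarrow> \<phi> p \<in> T \<longleftrightarrow> f p \<in> V"
proof -
  have "continuous_map (subtopology (man_top M) S) (man_top M') f" "S \<subseteq> pts M"
    using assms(3) by (auto simp: smooth_map_on_def)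
  then have "openin (subtopology (man_top M) S) {p \<in> S. f p \<in> V}"
    using assms(4) openin_continuous_map_preimage[of "subtopology (man_top M) S" "man_top M'" f V]
    by (simp add: inf_absorb2)
  then obtain Y where "openin (man_top M) Y" "{p \<in> S. f p \<in> V} = Y \<inter> S"
    by (auto simp: openin_subtopology)
  moreover from chart_open_image[OF assms(1,2) this(1)] obtain T
    where "open T" "\<And>p. p \<in> U \<Longrightarrow> \<phi> p \<in> T \<longleftrightarrow> p \<in> Y" by metis
  ultimately show ?thesis using that[of T] by blast
qed

text \<open>Around a point \<open>p\<close>, a chart \<open>(Y, \<eta>)\<close> at \<open>f p\<close> factors the local representative of
  \<open>g \<circ> f\<close> into those of \<open>f\<close> and \<open>g\<close>, and the composition of their smooth extensions extends it. The
  factorization is valid only where \<open>f\<close> takes values in \<open>Y\<close>; the open set \<open>T\<close> enforces this.\<close>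

lemma smooth_map_on_compose:
  assumes M: "smooth_manifold M" and M': "covered_by_charts M'"
    and f: "smooth_map_on M M' S f" and g: "smooth_map_on M' M'' S' g" and "f ` S \<subseteq> S'"
  shows "smooth_map_on M M'' S (g \<circ> f)"
proof -
  have "continuous_map (subtopology (man_top M) S) (subtopology (man_top M') S') f"
    using f \<open>f ` S \<subseteq> S'\<close> by (auto simp: smooth_map_on_def continuous_map_in_subtopology)
  then have cont: "continuous_map (subtopology (man_top M) S) (man_top M'') (g \<circ> f)"
    by (rule continuous_map_compose) (use g in \<open>simp add: smooth_map_on_def\<close>)
  have "smooth_on (\<psi> \<circ> (g \<circ> f) \<circ> inv_into U \<phi>) (\<phi> ` {p \<in> U \<inter> S. (g \<circ> f) p \<in> V})"
    if U: "(U, \<phi>) \<in> man_atlas M" and V: "(V, \<psi>) \<in> man_atlas M''" for U \<phi> V \<psi>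
    unfolding smooth_on_def
  proof
    fix x assume "x \<in> \<phi> ` {p \<in> U \<inter> S. (g \<circ> f) p \<in> V}"
    then obtain p where p: "x = \<phi> p" "p \<in> U" "p \<in> S" "g (f p) \<in> V" by auto
    have inj: "inj_on \<phi> U" by (rule chart_inj[OF M U])
    obtain Y \<eta> where Y: "(Y, \<eta>) \<in> man_atlas M'" "f p \<in> Y" "openin (man_top M') Y" "inj_on \<eta> Y"
      using covered_by_chartsE[OF M' smooth_map_on_image[OF f p(3)]] by metis
    obtain T where T: "open T" "\<And>p. p \<in> U \<inter> S \<Longrightarrow> \<phi> p \<in> T \<longleftrightarrow> f p \<in> Y"
      using smooth_map_on_preimage[OF M U f Y(3)] by metis
    have sm: "smooth_on (\<eta> \<circ> f \<circ> inv_into U \<phi>) (\<phi> ` {p \<in> U \<inter> S. f p \<in> Y})"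
      using smooth_map_onD[OF f U Y(1)] .
    have mem: "x \<in> \<phi> ` {p \<in> U \<inter> S. f p \<in> Y}"
      using p Y(2) by blast
    obtain W1 g1 where 1: "open W1" "x \<in> W1" "\<And>k. Ck_on k g1 W1"
      "\<And>y. y \<in> \<phi> ` {p \<in> U \<inter> S. f p \<in> Y} \<Longrightarrow> y \<in> W1 \<Longrightarrow> (\<eta> \<circ> f \<circ> inv_into U \<phi>) y = g1 y"
      by (rule smooth_onE[OF sm mem]) (rule that)
    have g1: "g1 (\<phi> p') = \<eta> (f p')" if "p' \<in> U" "p' \<in> S" "f p' \<in> Y" "\<phi> p' \<in> W1" for p'
      using 1(4)[of "\<phi> p'"] that inj by (auto simp: inv_into_f_f)
    have sm: "smooth_on (\<psi> \<circ> g \<circ> inv_into Y \<eta>) (\<eta> ` {p \<in> Y \<inter> S'. g p \<in> V})"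
      using smooth_map_onD[OF g Y(1) V] .
    have mem: "\<eta> (f p) \<in> \<eta> ` {p \<in> Y \<inter> S'. g p \<in> V}"
      using p Y(2) \<open>f ` S \<subseteq> S'\<close> by auto
    obtain W2 g2 where 2: "open W2" "\<eta> (f p) \<in> W2" "\<And>k. Ck_on k g2 W2"
      "\<And>y. y \<in> \<eta> ` {p \<in> Y \<inter> S'. g p \<in> V} \<Longrightarrow> y \<in> W2 \<Longrightarrow> (\<psi> \<circ> g \<circ> inv_into Y \<eta>) y = g2 y"
      by (rule smooth_onE[OF sm mem]) (rule that)
    have g2: "g2 (\<eta> q) = \<psi> (g q)" if "q \<in> Y" "q \<in> S'" "g q \<in> V" "\<eta> q \<in> W2" for q
      using 2(4)[of "\<eta> q"] that Y(4) by (auto simp: inv_into_f_f)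
    let ?W = "T \<inter> (W1 \<inter> g1 -` W2)"
    have W: "open ?W"
      using T(1) continuous_open_preimage[OF Ck_on_continuous[OF 1(3)] 1(1) 2(1)] by blast
    show "\<exists>W g'. open W \<and> x \<in> W \<and> (\<forall>k. Ck_on k g' W) \<and>
        (\<forall>y\<in>\<phi> ` {p \<in> U \<inter> S. (g \<circ> f) p \<in> V} \<inter> W. (\<psi> \<circ> (g \<circ> f) \<circ> inv_into U \<phi>) y = g' y)"
    proof (intro exI conjI allI ballI)
      show "open ?W" by (rule W)
      show "x \<in> ?W"
        using p T(2)[of p] Y(2) 1(2) g1[of p] 2(2) by simp
      show "Ck_on k (\<lambda>x. g2 (g1 x)) ?W" for k
        using W 2(1) _ Ck_on_subset[OF 1(3)] 2(3) by (rule Ck_on_compose) auto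
      fix y assume "y \<in> \<phi> ` {p \<in> U \<inter> S. (g \<circ> f) p \<in> V} \<inter> ?W"
      then obtain p' where p': "y = \<phi> p'" "p' \<in> U" "p' \<in> S" "g (f p') \<in> V"
        "y \<in> T" "y \<in> W1" "g1 y \<in> W2" by auto
      then have "f p' \<in> Y" "f p' \<in> S'" using T(2)[of p'] \<open>f ` S \<subseteq> S'\<close> by auto
      moreover have "g1 y = \<eta> (f p')" using p' calculation g1 by simp
      ultimately show "(\<psi> \<circ> (g \<circ> f) \<circ> inv_into U \<phi>) y = g2 (g1 y)"
        using p' g2[of "f p'"] inj by (simp add: inv_into_f_f)
    qed
  qed
  then show ?thesis
    using f cont by (auto simp: smooth_map_on_def)
qed

lemma smooth_map_on_Pair:
  assumes f: "smooth_map_on M A S f" and g: "smooth_map_on M B S g"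
  shows "smooth_map_on M (prod_manifold A B) S (\<lambda>x. (f x, g x))"
proof -
  have cont: "continuous_map (subtopology (man_top M) S) (man_top (prod_manifold A B)) (\<lambda>x. (f x, g x))"
    using f g by (simp add: smooth_map_on_def prod_manifold_def continuous_map_pairedI)
  have "smooth_on (\<theta> \<circ> (\<lambda>x. (f x, g x)) \<circ> inv_into U \<phi>) (\<phi> ` {p \<in> U \<inter> S. (f p, g p) \<in> Z})"
    if U: "(U, \<phi>) \<in> man_atlas M" and Z: "(Z, \<theta>) \<in> man_atlas (prod_manifold A B)" for U \<phi> Z \<theta>
  proof -
    obtain V \<psi> Y \<eta> where VY: "Z = V \<times> Y" "\<theta> = map_prod \<psi> \<eta>"
      "(V, \<psi>) \<in> man_atlas A" "(Y, \<eta>) \<in> man_atlas B"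
      using Z by (auto simp: prod_manifold_def)
    have "smooth_on (\<psi> \<circ> f \<circ> inv_into U \<phi>) (\<phi> ` {p \<in> U \<inter> S. f p \<in> V})"
      "smooth_on (\<eta> \<circ> g \<circ> inv_into U \<phi>) (\<phi> ` {p \<in> U \<inter> S. g p \<in> Y})"
      using smooth_map_onD[OF f U VY(3)] smooth_map_onD[OF g U VY(4)] .
    then have "smooth_on (\<psi> \<circ> f \<circ> inv_into U \<phi>) (\<phi> ` {p \<in> U \<inter> S. (f p, g p) \<in> Z})"
      "smooth_on (\<eta> \<circ> g \<circ> inv_into U \<phi>) (\<phi> ` {p \<in> U \<inter> S. (f p, g p) \<in> Z})"
      unfolding VY(1) by (auto elim: smooth_on_subset)
    from smooth_on_Pair[OF this] show ?thesis
      by (simp add: o_def VY(2))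
  qed
  then show ?thesis
    using f cont unfolding smooth_map_on_def by blast
qed

lemma smooth_map_on_const:
  assumes "S \<subseteq> pts M" "q \<in> pts M'"
  shows "smooth_map_on M M' S (\<lambda>x. q)"
proof -
  have "smooth_on (\<psi> \<circ> (\<lambda>x. q) \<circ> inv_into U \<phi>) T" for U T and \<psi> :: "'c \<Rightarrow> 'd" and \<phi> :: "'a \<Rightarrow> 'b"
    by (simp add: o_def smooth_on_Ck Ck_on_const)
  then show ?thesis
    using assms unfolding smooth_map_on_def by (simp add: case_prod_unfold)
qed

lemma smooth_map_on_id:
  assumes "smooth_manifold M" "S \<subseteq> pts M"
  shows "smooth_map_on M M S (\<lambda>x. x)"
proof -
  have "smooth_on (\<psi> \<circ> (\<lambda>x. x) \<circ> inv_into U \<phi>) (\<phi> ` {p \<in> U \<inter> S. p \<in> V})"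
    if "(U, \<phi>) \<in> man_atlas M" "(V, \<psi>) \<in> man_atlas M" for U \<phi> V \<psi>
  proof -
    have "smooth_transition (U, \<phi>) (V, \<psi>)"
      using assms(1) that unfolding smooth_manifold_def by blast
    then have "smooth_on (\<psi> \<circ> inv_into U \<phi>) (\<phi> ` (U \<inter> V))"
      by (simp add: smooth_transition_def)
    then show ?thesis unfolding o_def by (rule smooth_on_subset) auto
  qed
  then show ?thesis
    using assms(2) continuous_map_from_subtopology[OF continuous_map_id, unfolded id_def]
    unfolding smooth_map_on_def by blast
qed

lemma smooth_manifold_real_line: "smooth_manifold real_line"
proof -
  have "smooth_on (\<lambda>x::real. x) UNIV"
    by (simp add: smooth_on_Ck Ck_on_id)
  moreover have "second_countable (euclidean :: real topology)"
  proof -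
    obtain \<B> :: "real set set" where "countable \<B>" "\<And>C. C \<in> \<B> \<Longrightarrow> open C"
      "\<And>S. open S \<Longrightarrow> \<exists>U. U \<subseteq> \<B> \<and> S = \<Union>U"
      using univ_second_countable by metis
    then show ?thesis
      unfolding second_countable_def by (intro exI[of _ \<B>]) (simp, blast)
  qed
  moreover have "homeomorphic_map euclidean (euclidean :: real topology) id"
    by simp
  ultimately show ?thesis
    by (simp add: smooth_manifold_def real_line_def top_chart_def smooth_transition_def
        o_def inv_id id_def)
qed

section \<open>Velocities of curves\<close>

text \<open>The vector \<open>v\<close> is the velocity of \<open>c\<close> at time 0, in the preferred chart at \<open>c 0\<close>.
  Differentiability is required at this time only, which leaves room for the curves that the inverse
  function theorem produces.\<close>

definition has_velocity :: "('a, 'e::euclidean_space) manifold \<Rightarrow> (real \<Rightarrow> 'a) \<Rightarrow> 'e \<Rightarrow> bool" where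
  "has_velocity M c v \<longleftrightarrow>
     c 0 \<in> pts M \<and>
     (\<forall>\<^sub>F t in nhds 0. c t \<in> fst (chart_at M (c 0))) \<and>
     ((\<lambda>t. snd (chart_at M (c 0)) (c t)) has_vector_derivative v) (at 0)"

lemma chart_atE:
  assumes "smooth_manifold M" "p \<in> pts M"
  obtains U \<phi> where "chart_at M p = (U, \<phi>)" "(U, \<phi>) \<in> man_atlas M" "p \<in> U"
proof -
  have "\<exists>c. c \<in> man_atlas M \<and> p \<in> fst c"
    using covered_by_chartsE[OF smooth_manifold_covered[OF assms(1)] assms(2)]
    by (metis fst_conv)
  then have "chart_at M p \<in> man_atlas M \<and> p \<in> fst (chart_at M p)"
    unfolding chart_at_def by (rule someI_ex)
  then show thesis
    using that[of "fst (chart_at M p)" "snd (chart_at M p)"] by simp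
qed

lemma has_velocity_unique: "has_velocity M c v \<Longrightarrow> has_velocity M c w \<Longrightarrow> v = w"
  unfolding has_velocity_def by (elim conjE) (rule vector_derivative_unique_at)

lemma has_velocity_cong:
  assumes "has_velocity M c v" "\<forall>\<^sub>F t in nhds 0. c t = d t"
  shows "has_velocity M d v"
proof -
  have 0: "d 0 = c 0"
    using eventually_nhds_x_imp_x[OF assms(2)] by simp
  obtain A where A: "open A" "0 \<in> A" "\<And>t. t \<in> A \<Longrightarrow> c t = d t"
    using assms(2) unfolding eventually_nhds by blast
  let ?\<phi> = "snd (chart_at M (c 0))"
  have "((\<lambda>t. ?\<phi> (d t)) has_vector_derivative v) (at 0)"
    by (rule has_vector_derivative_transform_within_open[OF _ A(1,2), of "\<lambda>t. ?\<phi> (c t)"])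
      (use assms(1) A(3) in \<open>simp_all add: has_velocity_def\<close>)
  moreover have "\<forall>\<^sub>F t in nhds 0. c t \<in> fst (chart_at M (c 0))"
    using assms(1) by (simp add: has_velocity_def)
  then have "\<forall>\<^sub>F t in nhds 0. d t \<in> fst (chart_at M (c 0))"
    using assms(2) by eventually_elim simp
  ultimately show ?thesis
    using assms(1) by (simp add: has_velocity_def 0)
qed

lemma has_velocity_const:
  assumes "smooth_manifold M" "p \<in> pts M"
  shows "has_velocity M (\<lambda>t. p) 0"
proof -
  obtain U \<phi> where "chart_at M p = (U, \<phi>)" "p \<in> U"
    using chart_atE[OF assms] by metis
  then show ?thesis using assms(2) by (simp add: has_velocity_def)
qed

lemma has_vector_derivative_in_subspace:
  fixes f :: "real \<Rightarrow> 'e::euclidean_space"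
  assumes "subspace S" "(f has_vector_derivative v) (at 0)" "\<forall>\<^sub>F t in nhds 0. f t \<in> S"
  shows "v \<in> S"
proof -
  have "((\<lambda>t. (f t - f 0 - t *\<^sub>R v) /\<^sub>R norm t) \<longlongrightarrow> 0) (at_right 0)"
    using has_derivative_at_withinI[OF assms(2)[unfolded has_vector_derivative_def], of "{0<..}"]
    by (simp add: has_derivative_within divide_inverse diff_diff_eq)
  then have "((\<lambda>t. (f t - f 0 - t *\<^sub>R v) /\<^sub>R norm t + v) \<longlongrightarrow> 0 + v) (at_right 0)"
    by (intro tendsto_add tendsto_const)
  moreover have "\<forall>\<^sub>F t in at_right 0. (f t - f 0 - t *\<^sub>R v) /\<^sub>R norm t + v = (f t - f 0) /\<^sub>R t"
    using eventually_at_right_less[of "0::real"]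
    by eventually_elim (simp add: scaleR_diff_right)
  ultimately have "((\<lambda>t. (f t - f 0) /\<^sub>R t) \<longlongrightarrow> 0 + v) (at_right 0)"
    by (rule Lim_transform_eventually)
  then have lim: "((\<lambda>t. (f t - f 0) /\<^sub>R t) \<longlongrightarrow> v) (at_right 0)"
    by simp
  have "f 0 \<in> S" using eventually_nhds_x_imp_x[OF assms(3)] .
  have "\<forall>\<^sub>F t in at_right 0. f t \<in> S"
    using assms(3) by (rule filter_leD[OF at_within_le_nhds])
  then have "\<forall>\<^sub>F t in at_right 0. (f t - f 0) /\<^sub>R t \<in> S"
    by eventually_elim (use assms(1) \<open>f 0 \<in> S\<close> in \<open>simp add: subspace_diff subspace_scale\<close>)
  then show ?thesis
    by (rule Lim_in_closed_set[OF closed_subspace[OF assms(1)] _ _ lim]) simp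
qed

text \<open>The coordinates of the curve stay in the model space, which is closed, so the limit of the
  difference quotients does too.\<close>

lemma has_velocity_in_tangent_space:
  assumes "smooth_manifold M" "has_velocity M c v"
  shows "v \<in> tangent_space M (c 0)"
proof -
  have "c 0 \<in> pts M" using assms(2) by (simp add: has_velocity_def)
  then obtain U \<phi> where U: "chart_at M (c 0) = (U, \<phi>)" "(U, \<phi>) \<in> man_atlas M"
    using chart_atE[OF assms(1)] by metis
  have "\<phi> ` U \<subseteq> man_model M"
    using chart_open(2)[OF assms(1) U(2)] openin_imp_subset by blast
  then have "\<phi> (c t) \<in> man_model M" if "c t \<in> U" for t
    using that by blast
  moreover have "\<forall>\<^sub>F t in nhds 0. c t \<in> U"
    using assms(2) U(1) by (simp add: has_velocity_def)
  ultimately have "\<forall>\<^sub>F t in nhds 0. \<phi> (c t) \<in> man_model M"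
    by (rule eventually_mono[rotated])
  moreover have "((\<lambda>t. \<phi> (c t)) has_vector_derivative v) (at 0)"
    using assms(2) U(1) by (simp add: has_velocity_def)
  moreover have "subspace (man_model M)"
    using assms(1) by (simp add: smooth_manifold_def)
  ultimately show ?thesis by (intro has_vector_derivative_in_subspace)
qed

text \<open>The extension that smoothness provides represents \<open>f\<close> only at the points that \<open>f\<close> maps
  into the chart \<open>V\<close>. By continuity these include all points of \<open>S\<close> near \<open>p\<close>, so the derivative
  of the extension is also one within the image of \<open>U \<inter> S\<close>. The tangent map is some derivative
  within this image; it need not be the one of the extension.\<close>

lemma tangent_map_on_has_derivative:
  assumes M: "smooth_manifold M" and M': "smooth_manifold M'"
    and f: "smooth_map_on M M' S f" and p: "p \<in> S"
    and U: "chart_at M p = (U, \<phi>)" and V: "chart_at M' (f p) = (V, \<psi>)"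
  shows "((\<psi> \<circ> f \<circ> inv_into U \<phi>) has_derivative tangent_map_on M M' S f p)
           (at (\<phi> p) within \<phi> ` (U \<inter> S))"
proof -
  have "p \<in> pts M" using f p by (auto simp: smooth_map_on_def)
  then have U': "(U, \<phi>) \<in> man_atlas M" "p \<in> U"
    using chart_atE[OF M] U by (metis prod.inject)+
  have V': "(V, \<psi>) \<in> man_atlas M'" "f p \<in> V"
    using chart_atE[OF M' smooth_map_on_image[OF f p]] V by (metis prod.inject)+
  obtain T where T: "open T" "\<And>p. p \<in> U \<inter> S \<Longrightarrow> \<phi> p \<in> T \<longleftrightarrow> f p \<in> V"
    using smooth_map_on_preimage[OF M U'(1) f chart_open(1)[OF M' V'(1)]] by metis
  have mem: "\<phi> p \<in> \<phi> ` {p \<in> U \<inter> S. f p \<in> V}" using U' V' p by blast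
  obtain W g where W: "open W" "\<phi> p \<in> W" "\<And>k. Ck_on k g W"
    "\<And>y. y \<in> \<phi> ` {p \<in> U \<inter> S. f p \<in> V} \<Longrightarrow> y \<in> W \<Longrightarrow> (\<psi> \<circ> f \<circ> inv_into U \<phi>) y = g y"
    by (rule smooth_onE[OF smooth_map_onD[OF f U'(1) V'(1)] mem]) (rule that)
  have "(g has_derivative frechet_derivative g (at (\<phi> p))) (at (\<phi> p) within \<phi> ` (U \<inter> S))"
    using Ck_on_Suc_has_derivative[OF W(3) W(2)] by (rule has_derivative_at_withinI)
  moreover have "\<forall>\<^sub>F y in at (\<phi> p) within \<phi> ` (U \<inter> S). g y = (\<psi> \<circ> f \<circ> inv_into U \<phi>) y"
  proof -
    have "open (W \<inter> T)" "\<phi> p \<in> W \<inter> T" using W T V' U' p by auto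
    then show ?thesis
      unfolding eventually_at_topological
      using W(4) T(2) by (intro exI[of _ "W \<inter> T"]) auto
  qed
  moreover have "g (\<phi> p) = (\<psi> \<circ> f \<circ> inv_into U \<phi>) (\<phi> p)"
    using W(4)[OF mem W(2)] by simp
  moreover have "\<phi> p \<in> \<phi> ` (U \<inter> S)" using U' p by blast
  ultimately have "((\<psi> \<circ> f \<circ> inv_into U \<phi>) has_derivative frechet_derivative g (at (\<phi> p)))
           (at (\<phi> p) within \<phi> ` (U \<inter> S))"
    by (rule has_derivative_transform_eventually)
  then have "(\<psi> \<circ> f \<circ> inv_into U \<phi>) differentiable (at (\<phi> p) within \<phi> ` (U \<inter> S))"
    by (rule differentiableI)
  then show ?thesis
    by (simp add: frechet_derivative_works tangent_map_on_def U V)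
qed

lemma linear_tangent_map_on:
  assumes "smooth_manifold M" "smooth_manifold M'" "smooth_map_on M M' S f" "p \<in> S"
  shows "linear (tangent_map_on M M' S f p)"
proof -
  obtain U \<phi> V \<psi> where "chart_at M p = (U, \<phi>)" "chart_at M' (f p) = (V, \<psi>)"
    by (meson surj_pair)
  from tangent_map_on_has_derivative[OF assms this] show ?thesis
    by (rule has_derivative_linear)
qed

text \<open>The chain rule. Although the derivative within \<open>S\<close> may fail to be unique, each choice gives
  the same value on the velocity of a curve in \<open>S\<close>, because the composed curve is defined on a
  neighborhood of 0.\<close>

lemma has_velocity_push:
  assumes M: "smooth_manifold M" and M': "smooth_manifold M'"
    and f: "smooth_map_on M M' S f" and c: "has_velocity M c v" "\<forall>\<^sub>F t in nhds 0. c t \<in> S"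
  shows "has_velocity M' (f \<circ> c) (tangent_map_on M M' S f (c 0) v)"
proof -
  have c0: "c 0 \<in> pts M" "c 0 \<in> S"
    using c(1) eventually_nhds_x_imp_x[OF c(2)] by (auto simp: has_velocity_def)
  obtain U \<phi> where U: "chart_at M (c 0) = (U, \<phi>)" "(U, \<phi>) \<in> man_atlas M" "c 0 \<in> U"
    using chart_atE[OF M c0(1)] by metis
  have fc0: "f (c 0) \<in> pts M'" using smooth_map_on_image[OF f c0(2)] .
  obtain V \<psi> where V: "chart_at M' (f (c 0)) = (V, \<psi>)" "(V, \<psi>) \<in> man_atlas M'" "f (c 0) \<in> V"
    using chart_atE[OF M' fc0] by metis
  have inj: "inj_on \<phi> U" using chart_inj[OF M U(2)] .
  have "\<forall>\<^sub>F t in nhds 0. c t \<in> U"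
    using c(1) U(1) by (simp add: has_velocity_def)
  then have "\<forall>\<^sub>F t in nhds 0. c t \<in> U \<inter> S"
    using c(2) by eventually_elim simp
  then obtain A where A: "open A" "0 \<in> A" "\<And>t. t \<in> A \<Longrightarrow> c t \<in> U \<inter> S"
    by (auto simp: eventually_nhds)
  let ?D = "tangent_map_on M M' S f (c 0)"
  have vd: "((\<lambda>t. \<phi> (c t)) has_vector_derivative v) (at 0)"
    using c(1) U(1) by (simp add: has_velocity_def)
  have D: "((\<psi> \<circ> f \<circ> inv_into U \<phi>) has_derivative ?D) (at (\<phi> (c 0)) within \<phi> ` (U \<inter> S))"
    using tangent_map_on_has_derivative[OF M M' f c0(2) U(1) V(1)] .
  have sub: "(\<lambda>t. \<phi> (c t)) ` A \<subseteq> \<phi> ` (U \<inter> S)" using A(3) by blast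
  have "((\<lambda>t. \<phi> (c t)) has_derivative (\<lambda>t. t *\<^sub>R v)) (at 0 within A)"
    using vd unfolding has_vector_derivative_def by (rule has_derivative_at_withinI)
  from has_derivative_in_compose[OF this has_derivative_subset[OF D sub]]
  have "((\<lambda>t. (\<psi> \<circ> f \<circ> inv_into U \<phi>) (\<phi> (c t))) has_derivative (\<lambda>t. ?D (t *\<^sub>R v))) (at 0)"
    unfolding at_within_open[OF A(2,1)] .
  then have "((\<lambda>t. (\<psi> \<circ> f \<circ> inv_into U \<phi>) (\<phi> (c t))) has_vector_derivative ?D v) (at 0)"
    unfolding has_vector_derivative_def linear_cmul[OF linear_tangent_map_on[OF M M' f c0(2)]] .
  then have "((\<lambda>t. \<psi> (f (c t))) has_vector_derivative ?D v) (at 0)"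
    by (rule has_vector_derivative_transform_within_open[OF _ A(1,2)])
      (use A(3) inj in \<open>simp add: inv_into_f_f\<close>)
  moreover have "\<forall>\<^sub>F t in nhds 0. f (c t) \<in> V"
  proof -
    obtain T where T: "open T" "\<And>p. p \<in> U \<inter> S \<Longrightarrow> \<phi> p \<in> T \<longleftrightarrow> f p \<in> V"
      using smooth_map_on_preimage[OF M U(2) f chart_open(1)[OF M' V(2)]] by metis
    have "((\<lambda>t. \<phi> (c t)) \<longlongrightarrow> \<phi> (c 0)) (nhds 0)"
      using has_vector_derivative_continuous[OF vd]
      by (simp add: continuous_at tendsto_nhds_iff)
    moreover have "\<phi> (c 0) \<in> T" using T(2) U(3) c0(2) V(3) by blast
    ultimately have "\<forall>\<^sub>F t in nhds 0. \<phi> (c t) \<in> T"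
      by (rule topological_tendstoD[OF _ T(1)])
    then show ?thesis
      using \<open>\<forall>\<^sub>F t in nhds 0. c t \<in> U \<inter> S\<close> by eventually_elim (use T(2) in blast)
  qed
  ultimately show ?thesis
    using fc0 V(1) by (simp add: has_velocity_def)
qed

text \<open>On the real line the identity is a curve of velocity 1, which \<open>c\<close> as a smooth map pushes to \<open>c\<close> as a curve; thus the
  vectors that define tangent spaces of submanifolds are velocities in the present sense.\<close>

lemma curve_has_velocity:
  assumes "smooth_manifold M" "r > 0" "smooth_map_on real_line M {-r<..<r} c"
  shows "has_velocity M c (tangent_map_on real_line M {-r<..<r} c 0 1)"
proof -
  have ch: "chart_at real_line p = (UNIV, id)" for p
    unfolding chart_at_def real_line_def by (rule some_equality) auto
  have "has_velocity real_line (\<lambda>t. t) 1"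
    by (simp add: has_velocity_def ch) (simp add: real_line_def)
  moreover have "\<forall>\<^sub>F t in nhds 0. t \<in> {-r<..<r}"
    using assms(2) by (intro eventually_nhds_in_open) auto
  ultimately show ?thesis
    using has_velocity_push[OF smooth_manifold_real_line assms(1,3), of "\<lambda>t. t" 1]
    by (simp add: o_def)
qed

section \<open>Curves in the fibers of a submersion\<close>

text \<open>With \<open>D\<close> the derivative of \<open>g\<close> at \<open>x0\<close> and \<open>R\<close> a linear right inverse of \<open>D\<close> on
  \<open>D ` E\<close> with values in \<open>E\<close>, the map \<open>H x = x - x0 + R (g x - g x0 - D (x - x0))\<close> has derivative
  the identity at \<open>x0\<close>. Its local inverse \<open>K\<close> straightens the level set: the curve
  \<open>\<gamma> t = K (t a)\<close> has velocity \<open>a\<close>, and applying \<open>D\<close> to \<open>H (\<gamma> t) = t a\<close> cancels everything but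
  \<open>g (\<gamma> t) - g x0 = D (t a) = 0\<close>. The displacement \<open>\<gamma> t - x0 = t a - R (\<dots>)\<close> lies in \<open>E\<close>. The
  hypothesis on slices says that \<open>g\<close> maps \<open>x0 + E\<close> near \<open>x0\<close> into the affine space
  \<open>g x0 + D ` E\<close>, where \<open>D \<circ> R\<close> is the identity.\<close>

lemma curve_in_level_set:
  fixes g :: "'e::euclidean_space \<Rightarrow> 'f::euclidean_space"
  assumes W: "open W" "x0 \<in> W" and g: "Ck_on 1 g W" and E: "subspace E"
    and slice: "\<And>x. x \<in> W \<Longrightarrow> x - x0 \<in> E \<Longrightarrow> g x - g x0 \<in> frechet_derivative g (at x0) ` E"
    and a: "a \<in> E" "frechet_derivative g (at x0) a = 0"
  obtains \<gamma> where "\<gamma> 0 = x0" "(\<gamma> has_vector_derivative a) (at 0)"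
    "\<forall>\<^sub>F t in nhds 0. \<gamma> t \<in> W \<and> \<gamma> t - x0 \<in> E \<and> g (\<gamma> t) = g x0"
proof -
  define D where "D = (\<lambda>x. frechet_derivative g (at x))"
  have D: "(g has_derivative D x) (at x)" if "x \<in> W" for x
    using g that unfolding D_def One_nat_def by (rule Ck_on_Suc_has_derivative)
  have lin: "linear (D x)" if "x \<in> W" for x using has_derivative_linear[OF D[OF that]] .
  obtain R where R: "range R \<subseteq> E" "linear R" "\<And>v. v \<in> D x0 ` E \<Longrightarrow> D x0 (R v) = v"
    using linear_exists_right_inverse_on[OF lin[OF W(2)] E] by blast
  \<comment> \<open>The correction term vanishes to first order at \<open>x0\<close>.\<close>
  define H where "H = (\<lambda>x. x - x0 + R (g x - g x0 - D x0 (x - x0)))"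
  define H' where "H' = (\<lambda>x. Blinfun (\<lambda>h. h + R (D x h - D x0 h)))"
  have R': "bounded_linear R" using R(2) by (simp add: linear_conv_bounded_linear)
  have blin: "bounded_linear (\<lambda>h. h + R (D x h - D x0 h))" if "x \<in> W" for x
    using R' lin[OF that] lin[OF W(2)]
    by (intro bounded_linear_add bounded_linear_ident bounded_linear_compose[OF R']
        bounded_linear_sub) (simp_all add: linear_conv_bounded_linear)
  have H'_apply: "blinfun_apply (H' x) = (\<lambda>h. h + R (D x h - D x0 h))" if "x \<in> W" for x
    unfolding H'_def by (rule bounded_linear_Blinfun_apply[OF blin[OF that]])
  have D0: "bounded_linear (D x0)" using lin[OF W(2)] by (simp add: linear_conv_bounded_linear)
  have der: "(H has_derivative blinfun_apply (H' x)) (at x)" if x: "x \<in> W" for x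
  proof -
    have "((\<lambda>x. x - x0) has_derivative (\<lambda>h. h)) (at x)"
      by (auto intro!: derivative_eq_intros)
    moreover have "((\<lambda>x. g x - g x0 - D x0 (x - x0)) has_derivative (\<lambda>h. D x h - D x0 h)) (at x)"
      using has_derivative_diff[OF has_derivative_diff[OF D[OF x] has_derivative_const[of "g x0"]]
          bounded_linear.has_derivative[OF D0 calculation]] by simp
    ultimately show ?thesis
      unfolding H_def H'_apply[OF x]
      by (intro has_derivative_add bounded_linear.has_derivative[OF R'])
  qed
  have cont: "continuous_on W H'"
  proof (rule continuous_on_blinfun_componentwise)
    fix i :: 'e
    have "continuous_on W (\<lambda>x. D x i)"
      using g unfolding D_def by simp
    then have "continuous_on W (\<lambda>x. i + R (D x i - D x0 i))"
      by (intro continuous_on_add continuous_on_const bounded_linear.continuous_on[OF R']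
          continuous_on_diff)
    then show "continuous_on W (\<lambda>x. blinfun_apply (H' x) i)"
      by (simp add: H'_apply cong: continuous_on_cong)
  qed
  have H'0: "H' x0 = id_blinfun"
    by (rule blinfun_eqI) (simp add: H'_apply W(2) linear_0[OF R(2)])
  then have inv: "id_blinfun o\<^sub>L H' x0 = id_blinfun" by (simp add: blinfun_eqI)
  obtain U V K K' where K: "open U" "U \<subseteq> W" "x0 \<in> U" "open V" "H x0 \<in> V"
    "homeomorphism U V H K" "\<And>y. y \<in> V \<Longrightarrow> (K has_derivative K' y) (at y)"
    "\<And>y. y \<in> V \<Longrightarrow> K' y = inv (blinfun_apply (H' (K y)))"
    by (rule inverse_function_theorem[OF W(1) der cont W(2) inv]) (assumption, rule that)
  have H0: "H x0 = 0" by (simp add: H_def linear_0[OF R(2)] linear_0[OF lin[OF W(2)]])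
  have K0: "K 0 = x0" using homeomorphism_apply1[OF K(6,3)] H0 by simp
  have "blinfun_apply (H' x0) = id" unfolding H'0 by (rule ext) simp
  then have "K' 0 = id" using K(8)[OF K(5)] unfolding H0 K0 by (simp only: inv_id)
  define \<gamma> where "\<gamma> = (\<lambda>t. K (t *\<^sub>R a))"
  have "\<gamma> 0 = x0" by (simp add: \<gamma>_def K0)
  moreover have "(\<gamma> has_vector_derivative a) (at 0)"
  proof -
    have "((\<lambda>t::real. t *\<^sub>R a) has_derivative (\<lambda>t. t *\<^sub>R a)) (at 0)"
      by (auto intro!: derivative_eq_intros)
    moreover have "(K has_derivative (\<lambda>h. h)) (at (0 *\<^sub>R a))"
      using K(7)[OF K(5)] unfolding H0 \<open>K' 0 = id\<close> id_def scaleR_zero_left .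
    ultimately have "((\<lambda>t. K (t *\<^sub>R a)) has_derivative (\<lambda>t. t *\<^sub>R a)) (at 0)"
      by (rule has_derivative_compose)
    then show ?thesis
      unfolding \<gamma>_def has_vector_derivative_def .
  qed
  moreover have "\<forall>\<^sub>F t in nhds 0. \<gamma> t \<in> W \<and> \<gamma> t - x0 \<in> E \<and> g (\<gamma> t) = g x0"
  proof -
    have "((\<lambda>t::real. t *\<^sub>R a) \<longlongrightarrow> 0 *\<^sub>R a) (nhds 0)"
      by (intro tendsto_scaleR tendsto_const filterlim_ident)
    moreover have "0 *\<^sub>R a \<in> V" using K(5) H0 by simp
    ultimately have "\<forall>\<^sub>F t in nhds (0::real). t *\<^sub>R a \<in> V"
      by (rule topological_tendstoD[OF _ K(4)])
    then show ?thesis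
    proof eventually_elim
      case (elim t)
      have W': "\<gamma> t \<in> W"
        using K(2) elim homeomorphism_image2[OF K(6)] unfolding \<gamma>_def by blast
      have H: "H (\<gamma> t) = t *\<^sub>R a"
        unfolding \<gamma>_def using homeomorphism_apply2[OF K(6) elim] .
      let ?w = "g (\<gamma> t) - g x0 - D x0 (\<gamma> t - x0)"
      have eq: "\<gamma> t - x0 = t *\<^sub>R a - R ?w"
        by (rule eq_diff_eq[THEN iffD2]) (use H in \<open>simp only: H_def\<close>)
      have E': "\<gamma> t - x0 \<in> E"
        by (rule ssubst[OF eq], rule subspace_diff[OF E subspace_scale[OF E a(1)]])
          (use R(1) in blast)
      have "subspace (D x0 ` E)" using lin[OF W(2)] E by (rule linear_subspace_image)
      moreover have "g (\<gamma> t) - g x0 \<in> D x0 ` E" "D x0 (\<gamma> t - x0) \<in> D x0 ` E"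
        using slice[OF W' E'] E' by (simp_all add: D_def)
      ultimately have "?w \<in> D x0 ` E"
        by (rule subspace_diff)
      then have "D x0 (R ?w) = ?w" by (rule R(3))
      have "D x0 (t *\<^sub>R a) = t *\<^sub>R D x0 a" by (rule linear_cmul[OF lin[OF W(2)]])
      also have "\<dots> = 0" using a(2) by (simp add: D_def)
      finally have Da: "D x0 (t *\<^sub>R a) = 0" .
      have "D x0 (\<gamma> t - x0) = D x0 (t *\<^sub>R a) - D x0 (R ?w)"
        by (rule trans[OF arg_cong[OF eq, of "D x0"]]) (rule linear_diff[OF lin[OF W(2)]])
      then have "D x0 (\<gamma> t - x0) = 0 - ?w"
        unfolding Da \<open>D x0 (R ?w) = ?w\<close> .
      moreover have "w = 0" if "u = 0 - (w - u)" for u w :: 'f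
        using that by simp
      ultimately have "g (\<gamma> t) - g x0 = 0" by blast
      then have "g (\<gamma> t) = g x0" by (rule eq_iff_diff_eq_0[THEN iffD2])
      with W' E' show ?case by blast
    qed
  qed
  ultimately show thesis by (rule that)
qed

text \<open>The kernel of the differential of a submersion consists of velocities of curves in the fiber. In
  charts, the smooth extension \<open>g\<close> of the representative of \<open>f\<close> satisfies the hypotheses of
  \<open>curve_in_level_set\<close> with the model space of \<open>M\<close> as \<open>E\<close>.\<close>

lemma submersion_kernel_velocity:
  assumes M: "smooth_manifold M" and M': "smooth_manifold M'" and f: "submersion M M' f"
    and p: "p \<in> pts M" and a: "a \<in> tangent_space M p" "tangent_map M M' f p a = 0"
  obtains c where "c 0 = p" "has_velocity M c a" "\<forall>\<^sub>F t in nhds 0. c t \<in> pts M \<and> f (c t) = f p"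
proof -
  have sm: "smooth_map M M' f" and onto: "tangent_map M M' f p ` man_model M = man_model M'"
    using f p by (simp_all add: submersion_def)
  obtain U \<phi> where U: "chart_at M p = (U, \<phi>)" "(U, \<phi>) \<in> man_atlas M" "p \<in> U"
    using chart_atE[OF M p] by metis
  have fp: "f p \<in> pts M'" using smooth_map_on_image[OF sm p] .
  obtain V \<psi> where V: "chart_at M' (f p) = (V, \<psi>)" "(V, \<psi>) \<in> man_atlas M'" "f p \<in> V"
    using chart_atE[OF M' fp] by metis
  have inj: "inj_on \<phi> U" "inj_on \<psi> V" using chart_inj[OF M U(2)] chart_inj[OF M' V(2)] .
  have E: "subspace (man_model M)" "subspace (man_model M')"
    using M M' by (simp_all add: smooth_manifold_def)
  have "U \<subseteq> pts M" using chart_open(1)[OF M U(2)] by (rule openin_subset)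
  have "\<psi> ` V \<subseteq> man_model M'" using chart_open(2)[OF M' V(2)] openin_imp_subset by blast
  obtain T where T: "open T" "\<And>p. p \<in> U \<inter> pts M \<Longrightarrow> \<phi> p \<in> T \<longleftrightarrow> f p \<in> V"
    using smooth_map_on_preimage[OF M U(2) sm chart_open(1)[OF M' V(2)]] by metis
  obtain Q where Q: "open Q" "\<phi> ` U = man_model M \<inter> Q"
    using chart_open(2)[OF M U(2)] unfolding openin_open by metis
  have mem: "\<phi> p \<in> \<phi> ` {p \<in> U \<inter> pts M. f p \<in> V}" using U V p by blast
  obtain W g where W: "open W" "\<phi> p \<in> W" "\<And>k. Ck_on k g W"
    "\<And>y. y \<in> \<phi> ` {p \<in> U \<inter> pts M. f p \<in> V} \<Longrightarrow> y \<in> W \<Longrightarrow> (\<psi> \<circ> f \<circ> inv_into U \<phi>) y = g y"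
    by (rule smooth_onE[OF smooth_map_onD[OF sm U(2) V(2)] mem]) (rule that)
  \<comment> \<open>On the points of \<open>W0\<close> in the model space, the chart can be inverted, \<open>f\<close> lands in \<open>V\<close>, and \<open>g\<close>
    represents \<open>f\<close>.\<close>
  define W0 where "W0 = W \<inter> T \<inter> Q"
  have x0: "\<phi> p \<in> man_model M" "\<phi> p \<in> Q" using Q(2) U(3) by blast+
  have W0: "open W0" "\<phi> p \<in> W0" "Ck_on 1 g W0"
    using W(1,2) T Q(1) x0(2) U(3) p V(3) Ck_on_subset[OF W(3), of W0]
    by (simp_all add: W0_def open_Int inf_assoc)
  have chart: "inv_into U \<phi> x \<in> U \<and> \<phi> (inv_into U \<phi> x) = x \<and> f (inv_into U \<phi> x) \<in> V \<and>
      \<psi> (f (inv_into U \<phi> x)) = g x" if "x \<in> W0" "x - \<phi> p \<in> man_model M" for x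
  proof -
    have "x - \<phi> p + \<phi> p \<in> man_model M" using that(2) x0(1) by (rule subspace_add[OF E(1)])
    then have "x \<in> \<phi> ` U" using that(1) Q(2) by (simp add: W0_def)
    then obtain p' where p': "x = \<phi> p'" "p' \<in> U" by blast
    have "p' \<in> pts M" using p'(2) \<open>U \<subseteq> pts M\<close> by blast
    then have "f p' \<in> V" using that(1) T(2)[of p'] p' by (simp add: W0_def)
    moreover have "x \<in> \<phi> ` {p \<in> U \<inter> pts M. f p \<in> V}"
      using p' \<open>p' \<in> pts M\<close> calculation by blast
    ultimately show ?thesis
      using W(4)[of x] that(1) p' inj(1) by (simp add: W0_def inv_into_f_f)
  qed
  have lift: "has_velocity M (\<lambda>t. inv_into U \<phi> (\<gamma> t)) v"
    if \<gamma>: "\<gamma> 0 = \<phi> p" "(\<gamma> has_vector_derivative v) (at 0)"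
      "\<forall>\<^sub>F t in nhds 0. \<gamma> t \<in> W0 \<and> \<gamma> t - \<phi> p \<in> man_model M" for \<gamma> v
  proof -
    have 0: "inv_into U \<phi> (\<gamma> 0) = p" using \<gamma>(1) U(3) inj(1) by (simp add: inv_into_f_f)
    obtain A where A: "open A" "0 \<in> A" "\<And>t. t \<in> A \<Longrightarrow> \<gamma> t \<in> W0 \<and> \<gamma> t - \<phi> p \<in> man_model M"
      using \<gamma>(3) by (auto simp: eventually_nhds)
    have "((\<lambda>t. \<phi> (inv_into U \<phi> (\<gamma> t))) has_vector_derivative v) (at 0)"
      by (rule has_vector_derivative_transform_within_open[OF \<gamma>(2) A(1,2)]) (simp add: chart A(3))
    moreover have "\<forall>\<^sub>F t in nhds 0. inv_into U \<phi> (\<gamma> t) \<in> U"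
      using \<gamma>(3) by eventually_elim (simp add: chart)
    ultimately show ?thesis using p U(1) by (simp add: has_velocity_def 0)
  qed
  \<comment> \<open>Pushing the straight line in direction \<open>v\<close> through \<open>f\<close> computes the tangent map; through \<open>g\<close>, the full
    derivative of the extension.\<close>
  have Dg: "frechet_derivative g (at (\<phi> p)) v = tangent_map M M' f p v" if v: "v \<in> man_model M" for v
  proof -
    let ?\<gamma> = "\<lambda>t. \<phi> p + t *\<^sub>R v"
    have d: "(?\<gamma> has_vector_derivative v) (at 0)"
      unfolding has_vector_derivative_def by (auto intro!: derivative_eq_intros)
    have "(?\<gamma> \<longlongrightarrow> \<phi> p + 0 *\<^sub>R v) (nhds 0)"
      by (intro tendsto_add tendsto_scaleR tendsto_const filterlim_ident)
    then have "\<forall>\<^sub>F t in nhds 0. ?\<gamma> t \<in> W0"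
      by (rule topological_tendstoD[OF _ W0(1)]) (simp add: W0(2))
    then have ev: "\<forall>\<^sub>F t in nhds 0. ?\<gamma> t \<in> W0 \<and> ?\<gamma> t - \<phi> p \<in> man_model M"
      by eventually_elim (simp add: subspace_scale[OF E(1) v])
    have vel: "has_velocity M (\<lambda>t. inv_into U \<phi> (?\<gamma> t)) v"
      using lift[of ?\<gamma>] d ev by simp
    have ev': "\<forall>\<^sub>F t in nhds 0. inv_into U \<phi> (?\<gamma> t) \<in> pts M"
      using ev by eventually_elim (use chart \<open>U \<subseteq> pts M\<close> in blast)
    have 0: "inv_into U \<phi> (?\<gamma> 0) = p" using U(3) inj(1) by (simp add: inv_into_f_f)
    have "((\<lambda>t. \<psi> (f (inv_into U \<phi> (?\<gamma> t)))) has_vector_derivative tangent_map M M' f p v) (at 0)"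
      using has_velocity_push[OF M M' sm vel ev'] V(1) unfolding has_velocity_def 0 o_def by simp
    moreover have "((\<lambda>t. \<psi> (f (inv_into U \<phi> (?\<gamma> t)))) has_vector_derivative
        frechet_derivative g (at (\<phi> p)) v) (at 0)"
    proof -
      have g: "(g has_derivative frechet_derivative g (at (\<phi> p))) (at (?\<gamma> 0))"
        using Ck_on_Suc_has_derivative[OF W(3) W(2)] by simp
      have "((\<lambda>t. g (?\<gamma> t)) has_derivative (\<lambda>t. frechet_derivative g (at (\<phi> p)) (t *\<^sub>R v))) (at 0)"
        using d g unfolding has_vector_derivative_def by (rule has_derivative_compose)
      then have gd: "((\<lambda>t. g (?\<gamma> t)) has_vector_derivative frechet_derivative g (at (\<phi> p)) v) (at 0)"
        unfolding has_vector_derivative_def linear_cmul[OF has_derivative_linear[OF g]] .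
      obtain A where A: "open A" "0 \<in> A"
          "\<And>t. t \<in> A \<Longrightarrow> ?\<gamma> t \<in> W0 \<and> ?\<gamma> t - \<phi> p \<in> man_model M"
        using ev unfolding eventually_nhds by metis
      show ?thesis
        by (rule has_vector_derivative_transform_within_open[OF gd A(1,2)]) (use A(3) chart in metis)
    qed
    ultimately show ?thesis by (rule vector_derivative_unique_at[rotated])
  qed
  have slice: "g x - g (\<phi> p) \<in> frechet_derivative g (at (\<phi> p)) ` man_model M"
    if "x \<in> W0" "x - \<phi> p \<in> man_model M" for x
  proof -
    have g_model: "g x \<in> man_model M'" if "x \<in> W0" "x - \<phi> p \<in> man_model M" for x
    proof -
      have "g x = \<psi> (f (inv_into U \<phi> x))" "f (inv_into U \<phi> x) \<in> V"
        using chart[OF that] by simp_all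
      then show ?thesis using \<open>\<psi> ` V \<subseteq> man_model M'\<close> by blast
    qed
    have "g x \<in> man_model M'" "g (\<phi> p) \<in> man_model M'"
      using g_model[OF that] g_model[OF W0(2)] subspace_0[OF E(1)] by simp_all
    then have "g x - g (\<phi> p) \<in> tangent_map M M' f p ` man_model M"
      unfolding onto by (rule subspace_diff[OF E(2)])
    moreover have "frechet_derivative g (at (\<phi> p)) ` man_model M = tangent_map M M' f p ` man_model M"
      using Dg by (rule image_cong[OF refl])
    ultimately show ?thesis by (simp only:)
  qed
  have a': "frechet_derivative g (at (\<phi> p)) a = 0" using Dg[OF a(1)] a(2) by simp
  obtain \<gamma> where \<gamma>: "\<gamma> 0 = \<phi> p" "(\<gamma> has_vector_derivative a) (at 0)"
    "\<forall>\<^sub>F t in nhds 0. \<gamma> t \<in> W0 \<and> \<gamma> t - \<phi> p \<in> man_model M \<and> g (\<gamma> t) = g (\<phi> p)"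
    by (rule curve_in_level_set[OF W0 E(1) slice a(1) a']) (assumption, assumption, rule that)
  have "\<forall>\<^sub>F t in nhds 0. \<gamma> t \<in> W0 \<and> \<gamma> t - \<phi> p \<in> man_model M"
    using \<gamma>(3) by eventually_elim simp
  then have "has_velocity M (\<lambda>t. inv_into U \<phi> (\<gamma> t)) a"
    by (rule lift[OF \<gamma>(1,2)])
  moreover have "inv_into U \<phi> (\<gamma> 0) = p" using \<gamma>(1) U(3) inj(1) by (simp add: inv_into_f_f)
  moreover have "\<forall>\<^sub>F t in nhds 0. inv_into U \<phi> (\<gamma> t) \<in> pts M \<and> f (inv_into U \<phi> (\<gamma> t)) = f p"
    using \<gamma>(3)
  proof eventually_elim
    case (elim t)
    have "g (\<phi> p) = \<psi> (f p)"
      using chart[OF W0(2)] subspace_0[OF E(1)] U(3) inj(1) by (simp add: inv_into_f_f)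
    then have same: "\<psi> (f (inv_into U \<phi> (\<gamma> t))) = \<psi> (f p)" "f (inv_into U \<phi> (\<gamma> t)) \<in> V"
      using chart[of "\<gamma> t"] elim by simp_all
    then show ?case
      using inj_onD[OF inj(2) same V(3)] chart[of "\<gamma> t"] elim \<open>U \<subseteq> pts M\<close> by auto
  qed
  ultimately show thesis using that[of "\<lambda>t. inv_into U \<phi> (\<gamma> t)"] by blast
qed

section \<open>Translations and morphisms of Lie groupoids\<close>

lemma lie_groupoid_smooth:
  assumes "lie_groupoid \<G>"
  shows smooth_manifold_arr: "smooth_manifold (arr \<G>)"
    and smooth_manifold_obj: "smooth_manifold (obj \<G>)"
    and submersion_src: "submersion (arr \<G>) (obj \<G>) (src \<G>)"
    and smooth_mul: "smooth_map_on (prod_manifold (arr \<G>) (arr \<G>)) (arr \<G>) (composable \<G>)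
      (\<lambda>(g, h). mul \<G> g h)"
    and smooth_idt: "smooth_map (obj \<G>) (arr \<G>) (idt \<G>)"
    and smooth_ivs: "smooth_map (arr \<G>) (arr \<G>) (ivs \<G>)"
  using assms by (simp_all add: lie_groupoid_def)

lemma lie_groupoid_algebra:
  assumes "lie_groupoid \<G>"
  shows idt_in: "q \<in> pts (obj \<G>) \<Longrightarrow> idt \<G> q \<in> pts (arr \<G>)"
    and ivs_in: "g \<in> pts (arr \<G>) \<Longrightarrow> ivs \<G> g \<in> pts (arr \<G>)"
    and mul_assoc: "(g, h) \<in> composable \<G> \<Longrightarrow> (h, k) \<in> composable \<G> \<Longrightarrow>
      mul \<G> (mul \<G> g h) k = mul \<G> g (mul \<G> h k)"
    and src_idt: "q \<in> pts (obj \<G>) \<Longrightarrow> src \<G> (idt \<G> q) = q"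
    and tgt_idt: "q \<in> pts (obj \<G>) \<Longrightarrow> tgt \<G> (idt \<G> q) = q"
    and mul_idt_left: "g \<in> pts (arr \<G>) \<Longrightarrow> mul \<G> (idt \<G> (src \<G> g)) g = g"
    and mul_idt_right: "g \<in> pts (arr \<G>) \<Longrightarrow> mul \<G> g (idt \<G> (tgt \<G> g)) = g"
    and src_ivs: "g \<in> pts (arr \<G>) \<Longrightarrow> src \<G> (ivs \<G> g) = tgt \<G> g"
    and tgt_ivs: "g \<in> pts (arr \<G>) \<Longrightarrow> tgt \<G> (ivs \<G> g) = src \<G> g"
    and mul_ivs_right: "g \<in> pts (arr \<G>) \<Longrightarrow> mul \<G> g (ivs \<G> g) = idt \<G> (src \<G> g)"
    and mul_ivs_left: "g \<in> pts (arr \<G>) \<Longrightarrow> mul \<G> (ivs \<G> g) g = idt \<G> (tgt \<G> g)"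
proof -
  show "q \<in> pts (obj \<G>) \<Longrightarrow> idt \<G> q \<in> pts (arr \<G>)"
    using smooth_map_on_image[OF smooth_idt[OF assms]] .
  show "g \<in> pts (arr \<G>) \<Longrightarrow> ivs \<G> g \<in> pts (arr \<G>)"
    using smooth_map_on_image[OF smooth_ivs[OF assms]] .
  show "(g, h) \<in> composable \<G> \<Longrightarrow> (h, k) \<in> composable \<G> \<Longrightarrow>
      mul \<G> (mul \<G> g h) k = mul \<G> g (mul \<G> h k)"
    using assms unfolding lie_groupoid_def by blast
qed (use assms in \<open>simp_all add: lie_groupoid_def\<close>)

lemma composable_iff:
  "(g, h) \<in> composable \<G> \<longleftrightarrow> g \<in> pts (arr \<G>) \<and> h \<in> pts (arr \<G>) \<and> tgt \<G> g = src \<G> h"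
  by (simp add: composable_def)

lemma inverse_unique:
  assumes "lie_groupoid \<G>" "(x, y) \<in> composable \<G>" "mul \<G> x y = idt \<G> (src \<G> x)"
  shows "y = ivs \<G> x"
proof -
  have x: "x \<in> pts (arr \<G>)" "y \<in> pts (arr \<G>)" "tgt \<G> x = src \<G> y"
    using assms(2) by (simp_all add: composable_iff)
  have "y = mul \<G> (mul \<G> (ivs \<G> x) x) y"
    using mul_idt_left[OF assms(1) x(2)] mul_ivs_left[OF assms(1) x(1)] x(3) by simp
  also have "\<dots> = mul \<G> (ivs \<G> x) (mul \<G> x y)"
    using x assms(2) ivs_in[OF assms(1)] tgt_ivs[OF assms(1)] by (intro mul_assoc[OF assms(1)]) (simp_all add: composable_iff)
  also have "\<dots> = ivs \<G> x"
    using mul_idt_right[OF assms(1) ivs_in[OF assms(1) x(1)]] tgt_ivs[OF assms(1) x(1)] assms(3) by simp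
  finally show ?thesis .
qed

text \<open>Cancel one factor by multiplying with the inverse from the left.\<close>

lemma idempotent_is_identity:
  assumes "lie_groupoid \<G>" "(e, e) \<in> composable \<G>" "mul \<G> e e = e"
  shows "e = idt \<G> (src \<G> e)"
proof -
  have e: "e \<in> pts (arr \<G>)" "tgt \<G> e = src \<G> e"
    using assms(2) by (simp_all add: composable_iff)
  have "e = mul \<G> (mul \<G> (ivs \<G> e) e) e"
    using mul_idt_left[OF assms(1) e(1)] mul_ivs_left[OF assms(1) e(1)] e(2) by simp
  also have "\<dots> = mul \<G> (ivs \<G> e) (mul \<G> e e)"
    using e assms(2) ivs_in[OF assms(1)] tgt_ivs[OF assms(1)] by (intro mul_assoc[OF assms(1)]) (simp_all add: composable_iff)
  also have "\<dots> = idt \<G> (src \<G> e)"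
    using mul_ivs_left[OF assms(1) e(1)] e(2) assms(3) by simp
  finally show ?thesis .
qed

lemma ivs_idt:
  assumes "lie_groupoid \<G>" "q \<in> pts (obj \<G>)"
  shows "ivs \<G> (idt \<G> q) = idt \<G> q"
proof -
  have "mul \<G> (idt \<G> q) (idt \<G> q) = idt \<G> q"
    using mul_idt_left[OF assms(1) idt_in[OF assms(1) assms(2)]] src_idt[OF assms(1) assms(2)] by simp
  then show ?thesis
    using inverse_unique[OF assms(1), of "idt \<G> q" "idt \<G> q"] idt_in[OF assms(1) assms(2)] src_idt[OF assms(1) assms(2)] tgt_idt[OF assms(1) assms(2)]
    by (simp add: composable_iff)
qed

text \<open>A morphism preserves composition, hence idempotents, and the idempotents are the identities.\<close>

lemma morphism_idt:
  assumes "lie_groupoid \<G>" "lie_groupoid \<G>'" "groupoid_morphism \<G> \<G>' \<Phi>" "q \<in> pts (obj \<G>)"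
  shows "\<Phi> (idt \<G> q) = idt \<G>' (src \<G>' (\<Phi> (idt \<G> q)))"
proof -
  have "(idt \<G> q, idt \<G> q) \<in> composable \<G>"
    using idt_in[OF assms(1) assms(4)] src_idt[OF assms(1) assms(4)] tgt_idt[OF assms(1) assms(4)] by (simp add: composable_iff)
  moreover have "mul \<G> (idt \<G> q) (idt \<G> q) = idt \<G> q"
    using mul_idt_left[OF assms(1) idt_in[OF assms(1) assms(4)]] src_idt[OF assms(1) assms(4)] by simp
  ultimately have "(\<Phi> (idt \<G> q), \<Phi> (idt \<G> q)) \<in> composable \<G>'"
    "mul \<G>' (\<Phi> (idt \<G> q)) (\<Phi> (idt \<G> q)) = \<Phi> (idt \<G> q)"
    using assms(3) unfolding groupoid_morphism_def by fastforce+
  then show ?thesis by (rule idempotent_is_identity[OF assms(2)])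
qed

lemma morphism_composable:
  assumes "groupoid_morphism \<G> \<G>' \<Phi>" "(g, h) \<in> composable \<G>"
  shows "(\<Phi> g, \<Phi> h) \<in> composable \<G>'" "\<Phi> (mul \<G> g h) = mul \<G>' (\<Phi> g) (\<Phi> h)"
    "tgt \<G>' (\<Phi> g) = src \<G>' (\<Phi> h)"
proof -
  show *: "(\<Phi> g, \<Phi> h) \<in> composable \<G>'" "\<Phi> (mul \<G> g h) = mul \<G>' (\<Phi> g) (\<Phi> h)"
    using assms unfolding groupoid_morphism_def by blast+
  show "tgt \<G>' (\<Phi> g) = src \<G>' (\<Phi> h)" using *(1) by (simp add: composable_iff)
qed

lemma morphism_ivs:
  assumes "lie_groupoid \<G>" "lie_groupoid \<G>'" "groupoid_morphism \<G> \<G>' \<Phi>" "g \<in> pts (arr \<G>)"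
  shows "\<Phi> (ivs \<G> g) = ivs \<G>' (\<Phi> g)"
proof -
  let ?q = "src \<G> g"
  have q: "?q \<in> pts (obj \<G>)" using lie_groupoid_src_tgt_in[OF assms(1,4)] by simp
  have comp: "(g, ivs \<G> g) \<in> composable \<G>" "(idt \<G> ?q, g) \<in> composable \<G>"
    using assms(4) idt_in[OF assms(1) q] ivs_in[OF assms(1) assms(4)] src_ivs[OF assms(1) assms(4)] tgt_idt[OF assms(1) q]
    by (simp_all add: composable_iff)
  have "(idt \<G> ?q, idt \<G> ?q) \<in> composable \<G>"
    using idt_in[OF assms(1) q] src_idt[OF assms(1) q] tgt_idt[OF assms(1) q] by (simp add: composable_iff)
  then have "src \<G>' (\<Phi> (idt \<G> ?q)) = src \<G>' (\<Phi> g)"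
    using morphism_composable(3)[OF assms(3)] comp(2) by metis
  moreover have "mul \<G>' (\<Phi> g) (\<Phi> (ivs \<G> g)) = \<Phi> (idt \<G> ?q)"
    using morphism_composable(2)[OF assms(3) comp(1)] mul_ivs_right[OF assms(1) assms(4)] by simp
  ultimately have "mul \<G>' (\<Phi> g) (\<Phi> (ivs \<G> g)) = idt \<G>' (src \<G>' (\<Phi> g))"
    using morphism_idt[OF assms(1-3) q] by simp
  then show ?thesis
    by (rule inverse_unique[OF assms(2) morphism_composable(1)[OF assms(3) comp(1)]])
qed

lemma src_fiber_subset: "src_fiber \<G> q \<subseteq> pts (arr \<G>)"
  by (auto simp: src_fiber_def)

text \<open>This turns the smoothness of the multiplication on composable pairs into that of translations.\<close>

lemma smooth_mul_compose:
  assumes "lie_groupoid \<G>" "smooth_manifold M"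
    and "smooth_map_on M (arr \<G>) S a" "smooth_map_on M (arr \<G>) S b"
    and "\<And>x. x \<in> S \<Longrightarrow> (a x, b x) \<in> composable \<G>"
  shows "smooth_map_on M (arr \<G>) S (\<lambda>x. mul \<G> (a x) (b x))"
proof -
  have cov: "covered_by_charts (prod_manifold (arr \<G>) (arr \<G>))"
    by (intro prod_manifold_covered smooth_manifold_covered smooth_manifold_arr[OF assms(1)])
  have "(\<lambda>x. (a x, b x)) ` S \<subseteq> composable \<G>" using assms(5) by blast
  then have "smooth_map_on M (arr \<G>) S ((\<lambda>(g, h). mul \<G> g h) \<circ> (\<lambda>x. (a x, b x)))"
    by (rule smooth_map_on_compose[OF assms(2) cov smooth_map_on_Pair[OF assms(3,4)]
        smooth_mul[OF assms(1)]])
  then show ?thesis by (simp add: o_def)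
qed

lemma smooth_left_translation:
  assumes "lie_groupoid \<G>" "g \<in> pts (arr \<G>)"
  shows "smooth_map_on (arr \<G>) (arr \<G>) (src_fiber \<G> (tgt \<G> g)) (\<lambda>h. mul \<G> g h)"
  using smooth_map_on_const[OF src_fiber_subset assms(2)]
    smooth_map_on_id[OF smooth_manifold_arr[OF assms(1)] src_fiber_subset]
  by (rule smooth_mul_compose[OF assms(1) smooth_manifold_arr[OF assms(1)]])
    (use assms(2) in \<open>simp add: composable_iff src_fiber_def\<close>)

lemma smooth_right_translation:
  assumes "lie_groupoid \<G>" "g \<in> pts (arr \<G>)"
  shows "smooth_map_on (arr \<G>) (arr \<G>) (src_fiber \<G> (src \<G> g)) (\<lambda>h. mul \<G> (ivs \<G> h) g)"
  using smooth_map_on_subset[OF smooth_ivs[OF assms(1)] src_fiber_subset]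
    smooth_map_on_const[OF src_fiber_subset assms(2)]
  by (rule smooth_mul_compose[OF assms(1) smooth_manifold_arr[OF assms(1)]])
    (use assms(2) ivs_in[OF assms(1)] tgt_ivs[OF assms(1)] in \<open>simp add: composable_iff src_fiber_def\<close>)

lemma algebroid_velocity:
  assumes "lie_groupoid \<G>" "q \<in> pts (obj \<G>)" "a \<in> algebroid \<G> q"
  obtains c where "c 0 = idt \<G> q" "has_velocity (arr \<G>) c a" "\<forall>\<^sub>F t in nhds 0. c t \<in> src_fiber \<G> q"
proof -
  have a: "a \<in> tangent_space (arr \<G>) (idt \<G> q)"
    "tangent_map (arr \<G>) (obj \<G>) (src \<G>) (idt \<G> q) a = 0"
    using assms(3) by (simp_all add: algebroid_def)
  obtain c where c: "c 0 = idt \<G> q" "has_velocity (arr \<G>) c a"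
    "\<forall>\<^sub>F t in nhds 0. c t \<in> pts (arr \<G>) \<and> src \<G> (c t) = src \<G> (idt \<G> q)"
    by (rule submersion_kernel_velocity[OF smooth_manifold_arr[OF assms(1)] smooth_manifold_obj[OF assms(1)] submersion_src[OF assms(1)]
        idt_in[OF assms(1,2)] a]) (rule that)
  have "\<forall>\<^sub>F t in nhds 0. c t \<in> src_fiber \<G> q"
    using c(3) by eventually_elim (simp add: src_fiber_def src_idt[OF assms(1,2)])
  with c(1,2) show thesis by (rule that)
qed

lemma left_vec_velocity:
  assumes "lie_groupoid \<G>" "g \<in> pts (arr \<G>)"
    and "c 0 = idt \<G> (tgt \<G> g)" "has_velocity (arr \<G>) c a"
    and "\<forall>\<^sub>F t in nhds 0. c t \<in> src_fiber \<G> (tgt \<G> g)"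
  shows "has_velocity (arr \<G>) (\<lambda>t. mul \<G> g (c t)) (left_vec \<G> g a)"
  using has_velocity_push[OF smooth_manifold_arr[OF assms(1)] smooth_manifold_arr[OF assms(1)]
      smooth_left_translation[OF assms(1,2)] assms(4,5)]
  by (simp add: left_vec_def assms(3) o_def)

lemma right_vec_velocity:
  assumes "lie_groupoid \<G>" "g \<in> pts (arr \<G>)"
    and "c 0 = idt \<G> (src \<G> g)" "has_velocity (arr \<G>) c a"
    and "\<forall>\<^sub>F t in nhds 0. c t \<in> src_fiber \<G> (src \<G> g)"
  shows "has_velocity (arr \<G>) (\<lambda>t. mul \<G> (ivs \<G> (c t)) g) (- right_vec \<G> g a)"
  using has_velocity_push[OF smooth_manifold_arr[OF assms(1)] smooth_manifold_arr[OF assms(1)]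
      smooth_right_translation[OF assms(1,2)] assms(4,5)]
  by (simp add: right_vec_def assms(3) o_def)

text \<open>Invariant vectors are velocities of curves in \<open>G\<close>, hence genuine elements of the tangent space,
  where the relation between covectors applies.\<close>

lemma left_vec_tangent:
  assumes "lie_groupoid \<G>" "g \<in> pts (arr \<G>)" "a \<in> algebroid \<G> (tgt \<G> g)"
  shows "left_vec \<G> g a \<in> tangent_space (arr \<G>) g"
proof -
  obtain c where "c 0 = idt \<G> (tgt \<G> g)" "has_velocity (arr \<G>) c a"
    "\<forall>\<^sub>F t in nhds 0. c t \<in> src_fiber \<G> (tgt \<G> g)"
    by (rule algebroid_velocity[OF assms(1) lie_groupoid_src_tgt_in(2)[OF assms(1,2)] assms(3)]) (rule that)
  from left_vec_velocity[OF assms(1,2) this] show ?thesis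
    by (rule has_velocity_in_tangent_space[OF smooth_manifold_arr[OF assms(1)]])
qed

lemma right_vec_tangent:
  assumes "lie_groupoid \<G>" "g \<in> pts (arr \<G>)" "a \<in> algebroid \<G> (src \<G> g)"
  shows "right_vec \<G> g a \<in> tangent_space (arr \<G>) g"
proof -
  obtain c where "c 0 = idt \<G> (src \<G> g)" "has_velocity (arr \<G>) c a"
    "\<forall>\<^sub>F t in nhds 0. c t \<in> src_fiber \<G> (src \<G> g)"
    by (rule algebroid_velocity[OF assms(1) lie_groupoid_src_tgt_in(1)[OF assms(1,2)] assms(3)]) (rule that)
  from right_vec_velocity[OF assms(1,2) this]
  have "- right_vec \<G> g a \<in> tangent_space (arr \<G>) g"
    by (rule has_velocity_in_tangent_space[OF smooth_manifold_arr[OF assms(1)]])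
  moreover have "subspace (tangent_space (arr \<G>) g)"
    using smooth_manifold_arr[OF assms(1)] by (simp add: smooth_manifold_def)
  ultimately have "- (- right_vec \<G> g a) \<in> tangent_space (arr \<G>) g"
    by (rule subspace_neg[rotated])
  then show ?thesis by simp
qed

text \<open>If \<open>\<alpha>(h) = q\<close>, then \<open>\<epsilon>(q) h\<close> is defined, hence so is \<open>\<Phi>(\<epsilon>(q)) \<Phi>(h)\<close>. So the
  source of \<open>\<Phi>(h)\<close> is the target of \<open>\<Phi>(\<epsilon>(q))\<close>, a point \<open>q'\<close> that depends only on \<open>q\<close>.\<close>

lemma morphism_curve:
  assumes "lie_groupoid \<G>" "lie_groupoid \<G>'" "groupoid_morphism \<G> \<G>' \<Phi>" "q \<in> pts (obj \<G>)"
    and c: "c 0 = idt \<G> q" "has_velocity (arr \<G>) c a" "\<forall>\<^sub>F t in nhds 0. c t \<in> src_fiber \<G> q"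
  defines "q' \<equiv> src \<G>' (\<Phi> (idt \<G> q))"
  shows "\<Phi> (c 0) = idt \<G>' q'"
    and "has_velocity (arr \<G>') (\<lambda>t. \<Phi> (c t)) (tangent_map (arr \<G>) (arr \<G>') \<Phi> (idt \<G> q) a)"
    and "\<forall>\<^sub>F t in nhds 0. \<Phi> (c t) \<in> src_fiber \<G>' q'"
proof -
  have sm: "smooth_map (arr \<G>) (arr \<G>') \<Phi>"
    using assms(3) by (simp add: groupoid_morphism_def)
  show "\<Phi> (c 0) = idt \<G>' q'"
    unfolding c(1) q'_def by (rule morphism_idt[OF assms(1-4)])
  have "\<forall>\<^sub>F t in nhds 0. c t \<in> pts (arr \<G>)"
    using c(3) by eventually_elim (simp add: src_fiber_def)
  from has_velocity_push[OF smooth_manifold_arr[OF assms(1)] smooth_manifold_arr[OF assms(2)] sm c(2) this]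
  show "has_velocity (arr \<G>') (\<lambda>t. \<Phi> (c t)) (tangent_map (arr \<G>) (arr \<G>') \<Phi> (idt \<G> q) a)"
    by (simp add: o_def c(1))
  note idt = idt_in[OF assms(1,4)] src_idt[OF assms(1,4)] tgt_idt[OF assms(1,4)]
  have "(idt \<G> q, idt \<G> q) \<in> composable \<G>"
    using idt by (simp add: composable_iff)
  then have q': "tgt \<G>' (\<Phi> (idt \<G> q)) = q'"
    unfolding q'_def by (rule morphism_composable(3)[OF assms(3)])
  show "\<forall>\<^sub>F t in nhds 0. \<Phi> (c t) \<in> src_fiber \<G>' q'"
    using c(3)
  proof eventually_elim
    case (elim t)
    then have comp: "(idt \<G> q, c t) \<in> composable \<G>"
      using idt by (simp add: composable_iff src_fiber_def)
    have "\<Phi> (c t) \<in> pts (arr \<G>')"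
      using elim smooth_map_on_image[OF sm] by (simp add: src_fiber_def)
    then show ?case
      using morphism_composable(3)[OF assms(3) comp] q' by (simp add: src_fiber_def)
  qed
qed

text \<open>An element of the algebroid is the velocity of a curve in a source fiber. The image curve stays in a
  source fiber as well, so composed with the source map it is constant.\<close>

lemma morphism_algebroid:
  assumes "lie_groupoid \<G>" "lie_groupoid \<G>'" "groupoid_morphism \<G> \<G>' \<Phi>" "q \<in> pts (obj \<G>)"
    and "a \<in> algebroid \<G> q"
  shows "tangent_map (arr \<G>) (arr \<G>') \<Phi> (idt \<G> q) a
           \<in> algebroid \<G>' (src \<G>' (\<Phi> (idt \<G> q)))"
proof -
  let ?a = "tangent_map (arr \<G>) (arr \<G>') \<Phi> (idt \<G> q) a"
  define q' where "q' = src \<G>' (\<Phi> (idt \<G> q))"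
  note M' = smooth_manifold_arr[OF assms(2)] smooth_manifold_obj[OF assms(2)]
  obtain c where c: "c 0 = idt \<G> q" "has_velocity (arr \<G>) c a"
    "\<forall>\<^sub>F t in nhds 0. c t \<in> src_fiber \<G> q"
    by (rule algebroid_velocity[OF assms(1,4,5)]) (rule that)
  note c' = morphism_curve[OF assms(1-4) c, folded q'_def]
  have "?a \<in> tangent_space (arr \<G>') (idt \<G>' q')"
    using has_velocity_in_tangent_space[OF M'(1) c'(2)] .
  moreover have "tangent_map (arr \<G>') (obj \<G>') (src \<G>') (idt \<G>' q') ?a = 0"
  proof -
    have sm: "smooth_map (arr \<G>') (obj \<G>') (src \<G>')"
      using submersion_src[OF assms(2)] by (simp add: submersion_def)
    have "\<forall>\<^sub>F t in nhds 0. \<Phi> (c t) \<in> pts (arr \<G>')"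
      using c'(3) by eventually_elim (simp add: src_fiber_def)
    from has_velocity_push[OF M' sm c'(2) this]
    have "has_velocity (obj \<G>') (\<lambda>t. src \<G>' (\<Phi> (c t)))
        (tangent_map (arr \<G>') (obj \<G>') (src \<G>') (idt \<G>' q') ?a)"
      by (simp add: o_def c'(1))
    moreover have "\<forall>\<^sub>F t in nhds 0. src \<G>' (\<Phi> (c t)) = q'"
      using c'(3) by eventually_elim (simp add: src_fiber_def)
    ultimately have q': "has_velocity (obj \<G>') (\<lambda>t. q')
        (tangent_map (arr \<G>') (obj \<G>') (src \<G>') (idt \<G>' q') ?a)"
      by (rule has_velocity_cong)
    then have "q' \<in> pts (obj \<G>')"
      by (simp add: has_velocity_def)
    from has_velocity_const[OF M'(2) this] show ?thesis
      by (rule has_velocity_unique[OF q'])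
  qed
  ultimately show ?thesis by (simp add: algebroid_def q'_def)
qed

text \<open>Along a curve \<open>c\<close> of velocity \<open>a\<close> in the source fiber, the curves \<open>\<Phi>(g c(t))\<close> and
  \<open>\<Phi>(g) \<Phi>(c(t))\<close> agree. The left side is the velocity of the first, the right side that of the
  second.\<close>

lemma morphism_left_vec:
  assumes "lie_groupoid \<G>" "lie_groupoid \<G>'" "groupoid_morphism \<G> \<G>' \<Phi>" "g \<in> pts (arr \<G>)"
    and "a \<in> algebroid \<G> (tgt \<G> g)"
  shows "tangent_map (arr \<G>) (arr \<G>') \<Phi> g (left_vec \<G> g a) =
           left_vec \<G>' (\<Phi> g) (tangent_map (arr \<G>) (arr \<G>') \<Phi> (idt \<G> (tgt \<G> g)) a)"
proof -
  let ?q = "tgt \<G> g"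
  note M = smooth_manifold_arr[OF assms(1)] and M' = smooth_manifold_arr[OF assms(2)]
  have sm: "smooth_map (arr \<G>) (arr \<G>') \<Phi>"
    using assms(3) by (simp add: groupoid_morphism_def)
  have q: "?q \<in> pts (obj \<G>)" using lie_groupoid_src_tgt_in(2)[OF assms(1,4)] .
  obtain c where c: "c 0 = idt \<G> ?q" "has_velocity (arr \<G>) c a"
    "\<forall>\<^sub>F t in nhds 0. c t \<in> src_fiber \<G> ?q"
    by (rule algebroid_velocity[OF assms(1) q assms(5)]) (rule that)
  note c' = morphism_curve[OF assms(1-3) q c]
  have comp: "(g, h) \<in> composable \<G>" if "h \<in> src_fiber \<G> ?q" for h
    using that assms(4) by (simp add: composable_iff src_fiber_def)
  have "(g, idt \<G> ?q) \<in> composable \<G>"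
    using idt_in[OF assms(1) q] src_idt[OF assms(1) q] assms(4) by (simp add: composable_iff)
  then have q': "src \<G>' (\<Phi> (idt \<G> ?q)) = tgt \<G>' (\<Phi> g)"
    using morphism_composable(3)[OF assms(3)] by simp
  have "\<Phi> g \<in> pts (arr \<G>')" using smooth_map_on_image[OF sm assms(4)] .
  from left_vec_velocity[OF assms(2) this c'(1)[unfolded q'] c'(2) c'(3)[unfolded q']]
  have R: "has_velocity (arr \<G>') (\<lambda>t. mul \<G>' (\<Phi> g) (\<Phi> (c t)))
      (left_vec \<G>' (\<Phi> g) (tangent_map (arr \<G>) (arr \<G>') \<Phi> (idt \<G> ?q) a))" .
  have v: "has_velocity (arr \<G>) (\<lambda>t. mul \<G> g (c t)) (left_vec \<G> g a)"
    using left_vec_velocity[OF assms(1,4) c] .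
  have "\<forall>\<^sub>F t in nhds 0. mul \<G> g (c t) \<in> pts (arr \<G>)"
    using c(3) by eventually_elim
      (use smooth_map_on_image[OF smooth_left_translation[OF assms(1,4)]] in blast)
  from has_velocity_push[OF M M' sm v this]
  have "has_velocity (arr \<G>') (\<lambda>t. \<Phi> (mul \<G> g (c t)))
      (tangent_map (arr \<G>) (arr \<G>') \<Phi> g (left_vec \<G> g a))"
    by (simp add: o_def c(1) mul_idt_right[OF assms(1,4)])
  moreover have "\<forall>\<^sub>F t in nhds 0. \<Phi> (mul \<G> g (c t)) = mul \<G>' (\<Phi> g) (\<Phi> (c t))"
    using c(3) by eventually_elim (rule morphism_composable(2)[OF assms(3) comp])
  ultimately have "has_velocity (arr \<G>') (\<lambda>t. mul \<G>' (\<Phi> g) (\<Phi> (c t)))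
      (tangent_map (arr \<G>) (arr \<G>') \<Phi> g (left_vec \<G> g a))"
    by (rule has_velocity_cong)
  then show ?thesis using R by (rule has_velocity_unique)
qed

text \<open>The same comparison for \<open>\<Phi>(c(t)\<^sup>-\<^sup>1 g)\<close> and \<open>\<Phi>(c(t))\<^sup>-\<^sup>1 \<Phi>(g)\<close>, whose velocities are the negatives of
  the two sides.\<close>

lemma morphism_right_vec:
  assumes "lie_groupoid \<G>" "lie_groupoid \<G>'" "groupoid_morphism \<G> \<G>' \<Phi>" "g \<in> pts (arr \<G>)"
    and "a \<in> algebroid \<G> (src \<G> g)"
  shows "tangent_map (arr \<G>) (arr \<G>') \<Phi> g (right_vec \<G> g a) =
           right_vec \<G>' (\<Phi> g) (tangent_map (arr \<G>) (arr \<G>') \<Phi> (idt \<G> (src \<G> g)) a)"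
proof -
  let ?q = "src \<G> g"
  note M = smooth_manifold_arr[OF assms(1)] and M' = smooth_manifold_arr[OF assms(2)]
  have sm: "smooth_map (arr \<G>) (arr \<G>') \<Phi>"
    using assms(3) by (simp add: groupoid_morphism_def)
  have q: "?q \<in> pts (obj \<G>)" using lie_groupoid_src_tgt_in(1)[OF assms(1,4)] .
  obtain c where c: "c 0 = idt \<G> ?q" "has_velocity (arr \<G>) c a"
    "\<forall>\<^sub>F t in nhds 0. c t \<in> src_fiber \<G> ?q"
    by (rule algebroid_velocity[OF assms(1) q assms(5)]) (rule that)
  note c' = morphism_curve[OF assms(1-3) q c]
  note idt = idt_in[OF assms(1) q] src_idt[OF assms(1) q] tgt_idt[OF assms(1) q]
  have comp: "(ivs \<G> h, g) \<in> composable \<G>" if "h \<in> src_fiber \<G> ?q" for h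
    using that assms(4) ivs_in[OF assms(1)] tgt_ivs[OF assms(1)]
    by (simp add: composable_iff src_fiber_def)
  have "(idt \<G> ?q, g) \<in> composable \<G>" "(idt \<G> ?q, idt \<G> ?q) \<in> composable \<G>"
    using idt assms(4) by (simp_all add: composable_iff)
  then have q': "src \<G>' (\<Phi> (idt \<G> ?q)) = src \<G>' (\<Phi> g)"
    using morphism_composable(3)[OF assms(3)] by metis
  have "\<Phi> g \<in> pts (arr \<G>')" using smooth_map_on_image[OF sm assms(4)] .
  from right_vec_velocity[OF assms(2) this c'(1)[unfolded q'] c'(2) c'(3)[unfolded q']]
  have R: "has_velocity (arr \<G>') (\<lambda>t. mul \<G>' (ivs \<G>' (\<Phi> (c t))) (\<Phi> g))
      (- right_vec \<G>' (\<Phi> g) (tangent_map (arr \<G>) (arr \<G>') \<Phi> (idt \<G> ?q) a))" .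
  have v: "has_velocity (arr \<G>) (\<lambda>t. mul \<G> (ivs \<G> (c t)) g) (- right_vec \<G> g a)"
    using right_vec_velocity[OF assms(1,4) c] .
  have "\<forall>\<^sub>F t in nhds 0. mul \<G> (ivs \<G> (c t)) g \<in> pts (arr \<G>)"
    using c(3) by eventually_elim
      (use smooth_map_on_image[OF smooth_right_translation[OF assms(1,4)]] in blast)
  from has_velocity_push[OF M M' sm v this]
  have "has_velocity (arr \<G>') (\<lambda>t. \<Phi> (mul \<G> (ivs \<G> (c t)) g))
      (tangent_map (arr \<G>) (arr \<G>') \<Phi> g (- right_vec \<G> g a))"
    by (simp add: o_def c(1) ivs_idt[OF assms(1) q] mul_idt_left[OF assms(1,4)])
  moreover have "\<forall>\<^sub>F t in nhds 0.
      \<Phi> (mul \<G> (ivs \<G> (c t)) g) = mul \<G>' (ivs \<G>' (\<Phi> (c t))) (\<Phi> g)"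
    using c(3)
  proof eventually_elim
    case (elim t)
    then have "c t \<in> pts (arr \<G>)" by (simp add: src_fiber_def)
    then show ?case
      using morphism_composable(2)[OF assms(3) comp[OF elim]] morphism_ivs[OF assms(1-3)] by simp
  qed
  ultimately have "has_velocity (arr \<G>') (\<lambda>t. mul \<G>' (ivs \<G>' (\<Phi> (c t))) (\<Phi> g))
      (tangent_map (arr \<G>) (arr \<G>') \<Phi> g (- right_vec \<G> g a))"
    by (rule has_velocity_cong)
  then have "tangent_map (arr \<G>) (arr \<G>') \<Phi> g (- right_vec \<G> g a) =
      - right_vec \<G>' (\<Phi> g) (tangent_map (arr \<G>) (arr \<G>') \<Phi> (idt \<G> ?q) a)"
    using R by (rule has_velocity_unique)
  then show ?thesis
    using linear_neg[OF linear_tangent_map_on[OF M M' sm assms(4)]] by simp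
qed

section \<open>Morphisms of discrete constrained Lagrangian systems\<close>

lemma covectors_related_apply:
  assumes "covectors_related M M' \<Phi> (g, \<nu>) (g', \<nu>')" "v \<in> tangent_space M g"
  shows "\<nu> v = \<nu>' (tangent_map M M' \<Phi> g v)"
  using assms by (simp add: covectors_related_def)

text \<open>A vector tangent to \<open>N\<close> is the velocity of a smooth curve \<open>c\<close> in \<open>N\<close>. Its image
  is the velocity of the smooth curve \<open>\<Phi> \<circ> c\<close> in \<open>N'\<close>, hence tangent to \<open>N'\<close>, and
  \<open>L \<circ> c = L' \<circ> (\<Phi> \<circ> c)\<close> equates the two differentials.\<close>

lemma related_lagrangian_submanifold:
  assumes sys: "lagrangian_system \<G> N L" "lagrangian_system \<G>' N' L'"
    and mor: "lagrangian_morphism \<G> N L \<G>' N' L' \<Phi>"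
    and rel: "covectors_related (arr \<G>) (arr \<G>') \<Phi> (g, \<nu>) (g', \<nu>')"
    and cov: "(g, \<nu>) \<in> cotangent_bundle (arr \<G>)"
    and mem: "(g', \<nu>') \<in> lagrangian_submanifold \<G>' N' L'"
  shows "(g, \<nu>) \<in> lagrangian_submanifold \<G> N L"
proof -
  have M: "smooth_manifold (arr \<G>)" and M': "smooth_manifold (arr \<G>')"
    and L: "smooth_map_on (arr \<G>) real_line N L" and L': "smooth_map_on (arr \<G>') real_line N' L'"
    using sys smooth_manifold_arr[of \<G>] smooth_manifold_arr[of \<G>'] by (simp_all add: lagrangian_system_def)
  have \<Phi>: "smooth_map (arr \<G>) (arr \<G>') \<Phi>" and N: "N = {g \<in> pts (arr \<G>). \<Phi> g \<in> N'}"
    and LL': "\<And>g. g \<in> N \<Longrightarrow> L g = L' (\<Phi> g)"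
    using mor by (simp_all add: lagrangian_morphism_def groupoid_morphism_def)
  have g: "g \<in> pts (arr \<G>)" "g' = \<Phi> g"
    using cov rel by (simp_all add: cotangent_bundle_def covectors_related_def)
  have mem': "g' \<in> N'" "\<And>w. w \<in> tangent_space_of (arr \<G>') N' g' \<Longrightarrow>
      \<nu>' w = tangent_map_on (arr \<G>') real_line N' L' g' w"
    using mem by (simp_all add: lagrangian_submanifold_def)
  have "\<nu> v = tangent_map_on (arr \<G>) real_line N L g v"
    if v_tangent: "v \<in> tangent_space_of (arr \<G>) N g" for v
  proof -
    obtain c r where c: "v = tangent_map_on real_line (arr \<G>) {-r<..<r} c 0 1" "r > 0"
      "smooth_map_on real_line (arr \<G>) {-r<..<r} c" "c ` {-r<..<r} \<subseteq> N" "c 0 = g"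
      using v_tangent unfolding tangent_space_of_def by blast
    have v: "has_velocity (arr \<G>) c v"
      unfolding c(1) by (rule curve_has_velocity[OF M c(2,3)])
    have "\<forall>\<^sub>F t in nhds 0. t \<in> {-r<..<r}"
      using c(2) by (intro eventually_nhds_in_open) auto
    then have evN: "\<forall>\<^sub>F t in nhds 0. c t \<in> N"
      by eventually_elim (use c(4) in blast)
    then have ev: "\<forall>\<^sub>F t in nhds 0. c t \<in> pts (arr \<G>)"
      by eventually_elim (simp add: N)
    from evN have evN': "\<forall>\<^sub>F t in nhds 0. (\<Phi> \<circ> c) t \<in> N'"
      by eventually_elim (simp add: N)
    let ?w = "tangent_map (arr \<G>) (arr \<G>') \<Phi> g v"
    have w: "has_velocity (arr \<G>') (\<Phi> \<circ> c) ?w"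
      using has_velocity_push[OF M M' \<Phi> v ev] unfolding c(5) .
    have "c ` {-r<..<r} \<subseteq> pts (arr \<G>)" using c(4) N by blast
    then have sm: "smooth_map_on real_line (arr \<G>') {-r<..<r} (\<Phi> \<circ> c)"
      by (rule smooth_map_on_compose[OF smooth_manifold_real_line smooth_manifold_covered[OF M] c(3) \<Phi>])
    have "?w = tangent_map_on real_line (arr \<G>') {-r<..<r} (\<Phi> \<circ> c) 0 1"
      using w curve_has_velocity[OF M' c(2) sm] by (rule has_velocity_unique)
    moreover have "(\<Phi> \<circ> c) ` {-r<..<r} \<subseteq> N'" using c(4) N by auto
    ultimately have "?w \<in> tangent_space_of (arr \<G>') N' g'"
      unfolding tangent_space_of_def g(2) using c(2,5) sm
      by (intro CollectI exI[of _ "\<Phi> \<circ> c"] exI[of _ r] conjI) simp_all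
    then have "\<nu>' ?w = tangent_map_on (arr \<G>') real_line N' L' g' ?w"
      by (rule mem'(2))
    moreover have "has_velocity real_line (L' \<circ> (\<Phi> \<circ> c)) (tangent_map_on (arr \<G>') real_line N' L' g' ?w)"
      using has_velocity_push[OF M' smooth_manifold_real_line L' w evN'] c(5) g(2) by (simp add: o_def)
    moreover have "has_velocity real_line (L' \<circ> (\<Phi> \<circ> c)) (tangent_map_on (arr \<G>) real_line N L g v)"
    proof (rule has_velocity_cong)
      show "has_velocity real_line (L \<circ> c) (tangent_map_on (arr \<G>) real_line N L g v)"
        using has_velocity_push[OF M smooth_manifold_real_line L v evN] unfolding c(5) .
      show "\<forall>\<^sub>F t in nhds 0. (L \<circ> c) t = (L' \<circ> (\<Phi> \<circ> c)) t"
        using evN by eventually_elim (simp add: LL')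
    qed
    moreover have "\<nu> v = \<nu>' ?w"
      using has_velocity_in_tangent_space[OF M v] by (rule covectors_related_apply[OF rel])
    ultimately show ?thesis using has_velocity_unique by metis
  qed
  then show ?thesis
    using cov g mem'(1) by (simp add: lagrangian_submanifold_def N)
qed

text \<open>The same element \<open>a\<close> over \<open>\<beta>(g) = \<alpha>(h)\<close> enters both functionals and has one image in the algebroid
  of \<open>G'\<close>, at which the equation on \<open>G'\<close> is evaluated.\<close>

lemma related_cot_tgt_eq_cot_src:
  assumes G: "lie_groupoid \<G>" and G': "lie_groupoid \<G>'" and \<Phi>: "groupoid_morphism \<G> \<G>' \<Phi>"
    and comp: "(g, h) \<in> composable \<G>"
    and rel_g: "covectors_related (arr \<G>) (arr \<G>') \<Phi> (g, \<nu>) (g', \<nu>')"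
    and rel_h: "covectors_related (arr \<G>) (arr \<G>') \<Phi> (h, \<eta>) (h', \<eta>')"
    and eq: "cot_tgt \<G>' (g', \<nu>') = cot_src \<G>' (h', \<eta>')"
  shows "cot_tgt \<G> (g, \<nu>) = cot_src \<G> (h, \<eta>)"
proof -
  let ?q = "tgt \<G> g"
  have gh: "g \<in> pts (arr \<G>)" "h \<in> pts (arr \<G>)" "src \<G> h = ?q"
    using comp by (simp_all add: composable_iff)
  have q: "?q \<in> pts (obj \<G>)" using lie_groupoid_src_tgt_in(2)[OF G gh(1)] .
  have g': "g' = \<Phi> g" "h' = \<Phi> h"
    using rel_g rel_h by (simp_all add: covectors_related_def)
  have "(g, idt \<G> ?q) \<in> composable \<G>"
    using idt_in[OF G q] src_idt[OF G q] gh(1) by (simp add: composable_iff)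
  then have tgt: "src \<G>' (\<Phi> (idt \<G> ?q)) = tgt \<G>' (\<Phi> g)"
    using morphism_composable(3)[OF \<Phi>] by simp
  have src: "tgt \<G>' (\<Phi> g) = src \<G>' (\<Phi> h)"
    by (rule morphism_composable(3)[OF \<Phi> comp])
  have "\<nu> (left_vec \<G> g a) = \<eta> (right_vec \<G> h a)" if a: "a \<in> algebroid \<G> ?q" for a
  proof -
    let ?a = "tangent_map (arr \<G>) (arr \<G>') \<Phi> (idt \<G> ?q) a"
    have a': "?a \<in> algebroid \<G>' (tgt \<G>' (\<Phi> g))"
      using morphism_algebroid[OF G G' \<Phi> q a] unfolding tgt .
    have a_src: "a \<in> algebroid \<G> (src \<G> h)" using a gh(3) by simp
    have "\<nu> (left_vec \<G> g a) = \<nu>' (left_vec \<G>' (\<Phi> g) ?a)"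
      using covectors_related_apply[OF rel_g left_vec_tangent[OF G gh(1) a]]
        morphism_left_vec[OF G G' \<Phi> gh(1) a] by simp
    also have "\<dots> = snd (cot_tgt \<G>' (g', \<nu>')) ?a"
      using a' by (simp add: cot_tgt_def g')
    also have "\<dots> = snd (cot_src \<G>' (h', \<eta>')) ?a"
      by (simp only: eq)
    also have "\<dots> = \<eta>' (right_vec \<G>' (\<Phi> h) ?a)"
      using a' src by (simp add: cot_src_def g')
    also have "\<dots> = \<eta> (right_vec \<G> h a)"
      using covectors_related_apply[OF rel_h right_vec_tangent[OF G gh(2) a_src]]
        morphism_right_vec[OF G G' \<Phi> gh(2) a_src] gh(3) by simp
    finally show ?thesis .
  qed
  then show ?thesis
    using gh(3) by (simp add: cot_tgt_def cot_src_def cong: restrict_cong)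
qed

theorem corollary4p6:
  fixes \<G> :: "('g, 'e::euclidean_space, 'q, 'd::euclidean_space) groupoid"
    and \<G>' :: "('h, 'f::euclidean_space, 'r, 'c::euclidean_space) groupoid"
    and N :: "'g set" and N' :: "'h set"
    and L :: "'g \<Rightarrow> real" and L' :: "'h \<Rightarrow> real"
    and \<Phi> :: "'g \<Rightarrow> 'h"
    and n :: nat
    and \<mu> :: "nat \<Rightarrow> 'g \<times> ('e \<Rightarrow> real)"
    and \<mu>' :: "nat \<Rightarrow> 'h \<times> ('f \<Rightarrow> real)"
  assumes "lagrangian_system \<G> N L"
    and "lagrangian_system \<G>' N' L'"
    and "lagrangian_morphism \<G> N L \<G>' N' L' \<Phi>"
    and "\<forall>k\<in>{1..n}. \<mu>' k \<in> cotangent_bundle (arr \<G>')"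
    and "discrete_dynamics \<G>' N' L' n \<mu>'"
    and "\<forall>k\<in>{1..n}. \<mu> k \<in> cotangent_bundle (arr \<G>)"
    and "\<forall>k\<in>{1..n}. covectors_related (arr \<G>) (arr \<G>') \<Phi> (\<mu> k) (\<mu>' k)"
    and "\<forall>k\<in>{1..<n}. (fst (\<mu> k), fst (\<mu> (k + 1))) \<in> composable \<G>"
  shows "discrete_dynamics \<G> N L n \<mu>"
  unfolding discrete_dynamics_def
proof (intro conjI ballI)
  fix k assume k: "k \<in> {1..n}"
  have "\<mu>' k \<in> lagrangian_submanifold \<G>' N' L'"
    using assms(5) k by (simp add: discrete_dynamics_def)
  then show "\<mu> k \<in> lagrangian_submanifold \<G> N L"
    using related_lagrangian_submanifold[OF assms(1-3), of "fst (\<mu> k)" "snd (\<mu> k)"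
        "fst (\<mu>' k)" "snd (\<mu>' k)"] assms(6,7) k by simp
next
  fix k assume k: "k \<in> {1..<n}"
  then have k': "k \<in> {1..n}" "k + 1 \<in> {1..n}" by auto
  have G: "lie_groupoid \<G>" "lie_groupoid \<G>'" and \<Phi>: "groupoid_morphism \<G> \<G>' \<Phi>"
    using assms(1-3) by (simp_all add: lagrangian_system_def lagrangian_morphism_def)
  have eq: "cot_tgt \<G>' (\<mu>' k) = cot_src \<G>' (\<mu>' (k + 1))"
    using assms(5) k unfolding discrete_dynamics_def by blast
  show "cot_tgt \<G> (\<mu> k) = cot_src \<G> (\<mu> (k + 1))"
    using related_cot_tgt_eq_cot_src[OF G \<Phi> bspec[OF assms(8) k],
        of "snd (\<mu> k)" "fst (\<mu>' k)" "snd (\<mu>' k)" "snd (\<mu> (k + 1))" "fst (\<mu>' (k + 1))" "snd (\<mu>' (k + 1))"]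
      bspec[OF assms(7) k'(1)] bspec[OF assms(7) k'(2)] eq
    unfolding prod.collapse by blast
qed

end
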